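(* Let $G=G^{str}\cup G^{def}$ be a defeasible graph and $(s,p,o)$ a $\rho df_\bot$-triple. Then $G\models_{\min}(s,p,o)$ if and only if the procedure $\mathtt{StrictMinEntailment}(G,\mathrm{r}(G),(s,p,o))$ returns true, where $\mathrm{r}(G)$ is the output of $\mathtt{Ranking}(G)$.
   Context: **Syntax.** $U$ (URI references) and $L$ (literals, plain or typed) are disjoint sets; terms are the elements of $UL=U\cup L$. $\rho df_\bot=\{\mathsf{sp},\mathsf{sc},\mathsf{type},\mathsf{dom},\mathsf{range},\bot_c,\bot_p\}\subseteq U$. A ($\rho df_\bot$-)triple is $(s,p,o)\in UL\times U\times UL$ with $s,o\notin\rho df_\bot$; a graph is a finite set of triples; $\mathrm{uni}(G)$ is the set of terms occurring in it. A defeasible triple is $\langle s,p,o\rangle$ with $p\in\{\mathsf{sc},\mathsf{sp}\}$, $s,o\in UL\setminus\rho df_\bot$. A defeasible graph is $G=G^{str}\cup G^{def}$ with $G^{str}$ a graph and $G^{def}$ a finite set of defeasible triples. For a set $D$ of defeasible triples $D^s=\{(s,p,o):\langle s,p,o\rangle\in D\}$; $G^s=G^{str}\cup(G^{def})^s$. **Derivation.** Rules (metavariables range over $UL$): (2a) $(A,\mathsf{sp},B),(B,\mathsf{sp},C)\Rightarrow(A,\mathsf{sp},C)$; (2b) $(D,\mathsf{sp},E),(X,D,Y)\Rightarrow(X,E,Y)$; (3a) $(A,\mathsf{sc},B),(B,\mathsf{sc},C)\Rightarrow(A,\mathsf{sc},C)$; (3b) $(A,\mathsf{sc},B),(X,\mathsf{type},A)\Rightarrow(X,\mathsf{type},B)$;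 (4a) $(D,\mathsf{dom},B),(X,D,Y)\Rightarrow(X,\mathsf{type},B)$; (4b) $(D,\mathsf{range},B),(X,D,Y)\Rightarrow(Y,\mathsf{type},B)$; (5a) $(A,\bot_c,B)\Rightarrow(B,\bot_c,A)$; (5b) $(A,\bot_c,B),(C,\mathsf{sc},A)\Rightarrow(C,\bot_c,B)$; (5c) $(A,\bot_c,A)\Rightarrow(A,\bot_c,B)$; (6a) $(A,\bot_p,B)\Rightarrow(B,\bot_p,A)$; (6b) $(A,\bot_p,B),(C,\mathsf{sp},A)\Rightarrow(C,\bot_p,B)$; (6c) $(A,\bot_p,A)\Rightarrow(A,\bot_p,B)$; (7a) $(A,\mathsf{dom},C),(B,\mathsf{dom},D),(C,\bot_c,D)\Rightarrow(A,\bot_p,B)$; (7b) $(A,\mathsf{range},C),(B,\mathsf{range},D),(C,\bot_c,D)\Rightarrow(A,\bot_p,B)$. $\mathrm{Cl}(G)$ is the closure of $G$ under these rules; $G\vdash\tau$ means $\tau$ is derivable from $G$ by finitely many rule applications. **Interpretations.** An interpretation over $V\subseteq UL$ is $\mathcal I=\langle\Delta_R,\Delta_P,\Delta_C,\Delta_L,P[\cdot],C[\cdot],\cdot^{\mathcal I}\rangle$ with finite sets $\Delta_C\subseteq\Delta_R$, $L\cap V\subseteq\Delta_L\subseteq\Delta_R$, $\Delta_P$, maps $P:\Delta_P\to2^{\Delta_R\times\Delta_R}$, $C:\Delta_C\to2^{\Delta_R}$, and $\cdot^{\mathcal I}:UL\cap V\to\Delta_R\cup\Delta_P$, the identity on plain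 literals and mapping literals into $\Delta_R$. $\mathcal I\Vdash G$ iff $\mathcal I$ interprets (at least) $\rho df_\bot\cup\mathrm{uni}(G)$ and, writing $P_e=P[e^{\mathcal I}]$: for each $(s,p,o)\in G$, $p^{\mathcal I}\in\Delta_P$ and $(s^{\mathcal I},o^{\mathcal I})\in P[p^{\mathcal I}]$; $e^{\mathcal I}\in\Delta_P$ for $e\in\rho df_\bot$; $P_{\mathsf{sp}}$ is transitive over $\Delta_P$ and $(p,q)\in P_{\mathsf{sp}}$ implies $p,q\in\Delta_P$, $P[p]\subseteq P[q]$; $P_{\mathsf{sc}}$ is transitive over $\Delta_C$ and $(c,d)\in P_{\mathsf{sc}}$ implies $c,d\in\Delta_C$, $C[c]\subseteq C[d]$; $x\in C[c]$ iff $(x,c)\in P_{\mathsf{type}}$, and $(x,c)\in P_{\mathsf{type}}$ implies $c\in\Delta_C$; $(p,c)\in P_{\mathsf{dom}}$ (resp. $P_{\mathsf{range}}$) implies $p\in\Delta_P$, $c\in\Delta_C$ and, for all $(x,y)\in P[p]$, $x\in C[c]$ (resp. $y\in C[c]$); $P_{\bot_c}$ is a symmetric relation on $\Delta_C$ with: $(c,d)\in P_{\bot_c}$, $(e,c)\in P_{\mathsf{sc}}$ imply $(e,d)\in P_{\bot_c}$, and $(c,c)\in P_{\bot_c}$, $d\in\Delta_C$ imply $(c,d)\in P_{\bot_c}$; $P_{\bot_p}$ is a symmetric relation on $\Delta_P$ with the same two properties for $\mathsf{sp}$, $\Delta_P$; if $(p,c),(q,d)\in P_{\mathsf{dom}}$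 (or both in $P_{\mathsf{range}}$) and $(c,d)\in P_{\bot_c}$ then $(p,q)\in P_{\bot_p}$. **Ranked models.** For a defeasible graph $G$ fix the domains $\Delta_R=\mathrm{uni}(G^s)\cup\rho df_\bot$; $\Delta_P=\rho df_\bot\cup\{p\in\mathrm{uni}(G^s):p$ is the predicate of a triple, the subject or object of an $\mathsf{sp}$- or $\bot_p$-triple, or the subject of a $\mathsf{dom}$- or $\mathsf{range}$-triple of $\mathrm{Cl}(G^s)\}$; $\Delta_C=\{c\in\mathrm{uni}(G^s):c$ is the object of a $\mathsf{type}$-, $\mathsf{dom}$- or $\mathsf{range}$-triple, or the subject or object of an $\mathsf{sc}$- or $\bot_c$-triple of $\mathrm{Cl}(G^s)\}$; $\Delta_L=\mathrm{uni}(G^s)\cap L$. Let $\mathcal M$ be the set of all interpretations over $\rho df_\bot\cup\mathrm{uni}(G^s)$ with these domains. A ranked interpretation is $\mathcal R=(\mathcal M,r)$ with $r:\mathcal M\to\mathbb N\cup\{\infty\}$ attaining $0$ and such that if $r$ attains $i\in\mathbb N$, $i>0$, it attains $i-1$. $\mathcal M_{\mathbb N}=\{\mathcal I:r(\mathcal I)<\infty\}$. $\mathrm{cmin}(t,\mathcal R)$ (resp. $\mathrm{pmin}(t,\mathcal R)$) is the set of $\mathcal I\in\mathcal M_{\mathbb N}$ of least rank among those in $\mathcal M_{\mathbb N}$ with $\mathcal I\not\Vdash(t,\bot_c,t)$ (resp. $\mathcal I\not\Vdash(t,\bot_p,t)$). $\mathcal R\Vdash(s,p,o)$ iff all $\mathcal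 I\in\mathcal M_{\mathbb N}$ satisfy it; $\mathcal R\Vdash\langle c,\mathsf{sc},d\rangle$ iff $\mathcal I\Vdash(c,\mathsf{sc},d)$ for all $\mathcal I\in\mathrm{cmin}(c,\mathcal R)$; $\mathcal R\Vdash\langle p,\mathsf{sp},q\rangle$ iff $\mathcal I\Vdash(p,\mathsf{sp},q)$ for all $\mathcal I\in\mathrm{pmin}(p,\mathcal R)$. $\mathcal R$ is a ranked model of $G$ if it satisfies every element of $G$. Put $(\mathcal M,r)\preceq(\mathcal M,r')$ iff $r\le r'$ pointwise; $G$ has a unique $\preceq$-minimal ranked model $\mathcal R_{\min G}$. $G\models_{\min}\tau$ iff $\mathcal R_{\min G}\Vdash\tau$. **Procedures.** $\mathtt{Ranking}(G)$: $D_0=G^{def}$; $D_{i+1}=\{\langle p,\mathsf{sc},q\rangle\in D_i:G^{str}\cup D_i^s\vdash(p,\bot_c,p)\}\cup\{\langle p,\mathsf{sp},q\rangle\in D_i:G^{str}\cup D_i^s\vdash(p,\bot_p,p)\}$; let $n$ be least with $D_n=D_{n+1}$, $D_\infty=D_n$; output $\mathrm{r}(G)=\{D_0,\dots,D_n,D_\infty\}$. $\mathtt{StrictMinEntailment}(G,\mathrm{r}(G),(s,p,o))$ returns true iff $G'\vdash(s,p,o)$, where $G'=G^{str}\cup\{(a,\bot_c,a):\langle a,\mathsf{sc},b\rangle\in D_\infty\}\cup\{(a,\bot_p,a):\langle a,\mathsf{sp},b\rangle\in D_\infty\}$.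
   Formalization: The claim fails as stated: rule (5c) derives ⊥-triples with terms that are uninterpreted or denote non-classes. Here queries with predicate ⊥_c or ⊥_p must use terms of uni(G^s), and Δ_C is collected from uni(G^s) ∪ ρdf_⊥ rather than uni(G^s). *)

theory Defs
  imports "HOL-Library.FuncSet" "HOL-Library.Extended_Nat"
begin

section \<open>Syntax\<close>

text \<open>
  Terms: the seven reserved words and the remaining URI references form the set \<open>U\<close>; plain and
  typed literals form the set \<open>L\<close>. The three kinds of names are arbitrary types.
\<close>

datatype ('u, 'pl, 'tl) rdf_term =
    Sp | Sc | Typ | Dom | Rng | BotC | BotP
  | URI 'u | Plain 'pl | Typed 'tl

definition rdf_voc :: "('u, 'pl, 'tl) rdf_term set" where
  "rdf_voc = {Sp, Sc, Typ, Dom, Rng, BotC, BotP}"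

definition uris :: "('u, 'pl, 'tl) rdf_term set" where
  "uris = rdf_voc \<union> range URI"

definition plain_literals :: "('u, 'pl, 'tl) rdf_term set" where
  "plain_literals = range Plain"

definition literals :: "('u, 'pl, 'tl) rdf_term set" where
  "literals = range Plain \<union> range Typed"

text \<open>
  The type \<open>triple\<close> contains all of \<open>UL \<times> UL \<times> UL\<close>; \<open>is_triple\<close> singles out the proper triples.
  The metavariables of the rules range over all of \<open>UL\<close>, so a closure may contain improper triples.
\<close>

type_synonym ('u, 'pl, 'tl) triple =
  "('u, 'pl, 'tl) rdf_term \<times> ('u, 'pl, 'tl) rdf_term \<times> ('u, 'pl, 'tl) rdf_term"

definition is_triple :: "('u, 'pl, 'tl) triple \<Rightarrow> bool" where
  "is_triple = (\<lambda>(s, p, o'). p \<in> uris \<and> s \<notin> rdf_voc \<and> o' \<notin> rdf_voc)"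

definition is_graph :: "('u, 'pl, 'tl) triple set \<Rightarrow> bool" where
  "is_graph G \<longleftrightarrow> finite G \<and> (\<forall>t\<in>G. is_triple t)"

definition uni :: "('u, 'pl, 'tl) triple set \<Rightarrow> ('u, 'pl, 'tl) rdf_term set" where
  "uni G = (\<Union>(s, p, o')\<in>G. {s, p, o'})"

datatype ('u, 'pl, 'tl) dtriple =
  DTriple "('u, 'pl, 'tl) rdf_term" "('u, 'pl, 'tl) rdf_term" "('u, 'pl, 'tl) rdf_term"
    (\<open>\<langle>_,/ _,/ _\<rangle>\<close>)

fun is_dtriple :: "('u, 'pl, 'tl) dtriple \<Rightarrow> bool" where
  "is_dtriple \<langle>s, p, o'\<rangle> \<longleftrightarrow> p \<in> {Sc, Sp} \<and> s \<notin> rdf_voc \<and> o' \<notin> rdf_voc"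

fun strictify :: "('u, 'pl, 'tl) dtriple \<Rightarrow> ('u, 'pl, 'tl) triple" where
  "strictify \<langle>s, p, o'\<rangle> = (s, p, o')"

datatype ('u, 'pl, 'tl) dgraph =
  DGraph (str_part: "('u, 'pl, 'tl) triple set") (def_part: "('u, 'pl, 'tl) dtriple set")

definition is_dgraph :: "('u, 'pl, 'tl) dgraph \<Rightarrow> bool" where
  "is_dgraph G \<longleftrightarrow> is_graph (str_part G) \<and> finite (def_part G) \<and> (\<forall>d\<in>def_part G. is_dtriple d)"

definition strict_version :: "('u, 'pl, 'tl) dgraph \<Rightarrow> ('u, 'pl, 'tl) triple set" where
  "strict_version G = str_part G \<union> strictify ` def_part G"


section \<open>Derivation\<close>

inductive_set Cl :: "('u, 'pl, 'tl) triple set \<Rightarrow> ('u, 'pl, 'tl) triple set"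
  for G :: "('u, 'pl, 'tl) triple set" where
  base: "t \<in> G \<Longrightarrow> t \<in> Cl G"
| r2a: "(A, Sp, B) \<in> Cl G \<Longrightarrow> (B, Sp, C) \<in> Cl G \<Longrightarrow> (A, Sp, C) \<in> Cl G"
| r2b: "(D, Sp, E) \<in> Cl G \<Longrightarrow> (X, D, Y) \<in> Cl G \<Longrightarrow> (X, E, Y) \<in> Cl G"
| r3a: "(A, Sc, B) \<in> Cl G \<Longrightarrow> (B, Sc, C) \<in> Cl G \<Longrightarrow> (A, Sc, C) \<in> Cl G"
| r3b: "(A, Sc, B) \<in> Cl G \<Longrightarrow> (X, Typ, A) \<in> Cl G \<Longrightarrow> (X, Typ, B) \<in> Cl G"
| r4a: "(D, Dom, B) \<in> Cl G \<Longrightarrow> (X, D, Y) \<in> Cl G \<Longrightarrow> (X, Typ, B) \<in> Cl G"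
| r4b: "(D, Rng, B) \<in> Cl G \<Longrightarrow> (X, D, Y) \<in> Cl G \<Longrightarrow> (Y, Typ, B) \<in> Cl G"
| r5a: "(A, BotC, B) \<in> Cl G \<Longrightarrow> (B, BotC, A) \<in> Cl G"
| r5b: "(A, BotC, B) \<in> Cl G \<Longrightarrow> (C, Sc, A) \<in> Cl G \<Longrightarrow> (C, BotC, B) \<in> Cl G"
| r5c: "(A, BotC, A) \<in> Cl G \<Longrightarrow> (A, BotC, B) \<in> Cl G"
| r6a: "(A, BotP, B) \<in> Cl G \<Longrightarrow> (B, BotP, A) \<in> Cl G"
| r6b: "(A, BotP, B) \<in> Cl G \<Longrightarrow> (C, Sp, A) \<in> Cl G \<Longrightarrow> (C, BotP, B) \<in> Cl G"
| r6c: "(A, BotP, A) \<in> Cl G \<Longrightarrow> (A, BotP, B) \<in> Cl G"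
| r7a: "(A, Dom, C) \<in> Cl G \<Longrightarrow> (B, Dom, D) \<in> Cl G \<Longrightarrow> (C, BotC, D) \<in> Cl G \<Longrightarrow>
        (A, BotP, B) \<in> Cl G"
| r7b: "(A, Rng, C) \<in> Cl G \<Longrightarrow> (B, Rng, D) \<in> Cl G \<Longrightarrow> (C, BotC, D) \<in> Cl G \<Longrightarrow>
        (A, BotP, B) \<in> Cl G"

definition derives :: "('u, 'pl, 'tl) triple set \<Rightarrow> ('u, 'pl, 'tl) triple \<Rightarrow> bool"
    (infix \<open>\<turnstile>\<close> 50) where
  "G \<turnstile> t \<longleftrightarrow> t \<in> Cl G"


section \<open>Interpretations\<close>

text \<open>
  Resources are terms: \<open>L \<inter> V \<subseteq> \<Delta>\<^sub>L\<close> forces literals to be resources, and the domains fixed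
  for a defeasible graph below consist of terms. The field \<open>voc\<close> is the vocabulary \<open>V\<close>.
\<close>

record ('u, 'pl, 'tl) interp =
  voc :: "('u, 'pl, 'tl) rdf_term set"
  dR :: "('u, 'pl, 'tl) rdf_term set"
  dP :: "('u, 'pl, 'tl) rdf_term set"
  dC :: "('u, 'pl, 'tl) rdf_term set"
  dL :: "('u, 'pl, 'tl) rdf_term set"
  pext :: "('u, 'pl, 'tl) rdf_term \<Rightarrow> (('u, 'pl, 'tl) rdf_term \<times> ('u, 'pl, 'tl) rdf_term) set"
  cext :: "('u, 'pl, 'tl) rdf_term \<Rightarrow> ('u, 'pl, 'tl) rdf_term set"
  den :: "('u, 'pl, 'tl) rdf_term \<Rightarrow> ('u, 'pl, 'tl) rdf_term"

definition interpretation_over ::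
    "('u, 'pl, 'tl) rdf_term set \<Rightarrow> ('u, 'pl, 'tl) interp \<Rightarrow> bool" where
  "interpretation_over V I \<longleftrightarrow>
     voc I = V \<and>
     finite (dR I) \<and> finite (dP I) \<and> dC I \<subseteq> dR I \<and>
     literals \<inter> V \<subseteq> dL I \<and> dL I \<subseteq> dR I \<and>
     pext I \<in> dP I \<rightarrow>\<^sub>E Pow (dR I \<times> dR I) \<and>
     cext I \<in> dC I \<rightarrow>\<^sub>E Pow (dR I) \<and>
     den I \<in> V \<rightarrow>\<^sub>E dR I \<union> dP I \<and>
     (\<forall>l\<in>plain_literals \<inter> V. den I l = l) \<and>
     (\<forall>l\<in>literals \<inter> V. den I l \<in> dR I)"

text \<open>The relation \<open>P\<^sub>e = P[e\<^sup>I]\<close>.\<close>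

definition rel :: "('u, 'pl, 'tl) interp \<Rightarrow> ('u, 'pl, 'tl) rdf_term \<Rightarrow>
    (('u, 'pl, 'tl) rdf_term \<times> ('u, 'pl, 'tl) rdf_term) set" where
  "rel I e = pext I (den I e)"

definition sp_sc_conditions :: "('u, 'pl, 'tl) interp \<Rightarrow> bool" where
  "sp_sc_conditions I \<longleftrightarrow>
     trans_on (dP I) (rel I Sp) \<and>
     (\<forall>(p, q)\<in>rel I Sp. p \<in> dP I \<and> q \<in> dP I \<and> pext I p \<subseteq> pext I q) \<and>
     trans_on (dC I) (rel I Sc) \<and>
     (\<forall>(c, d)\<in>rel I Sc. c \<in> dC I \<and> d \<in> dC I \<and> cext I c \<subseteq> cext I d)"

definition typing_conditions :: "('u, 'pl, 'tl) interp \<Rightarrow> bool" where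
  "typing_conditions I \<longleftrightarrow>
     (\<forall>c\<in>dC I. \<forall>x. x \<in> cext I c \<longleftrightarrow> (x, c) \<in> rel I Typ) \<and>
     (\<forall>(x, c)\<in>rel I Typ. c \<in> dC I) \<and>
     (\<forall>(p, c)\<in>rel I Dom. p \<in> dP I \<and> c \<in> dC I \<and> (\<forall>(x, y)\<in>pext I p. x \<in> cext I c)) \<and>
     (\<forall>(p, c)\<in>rel I Rng. p \<in> dP I \<and> c \<in> dC I \<and> (\<forall>(x, y)\<in>pext I p. y \<in> cext I c))"

definition disjointness_conditions :: "('u, 'pl, 'tl) interp \<Rightarrow> bool" where
  "disjointness_conditions I \<longleftrightarrow>
     rel I BotC \<subseteq> dC I \<times> dC I \<and> sym (rel I BotC) \<and>
     (\<forall>c d e. (c, d) \<in> rel I BotC \<and> (e, c) \<in> rel I Sc \<longrightarrow> (e, d) \<in> rel I BotC) \<and>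
     (\<forall>c. (c, c) \<in> rel I BotC \<longrightarrow> (\<forall>d\<in>dC I. (c, d) \<in> rel I BotC)) \<and>
     rel I BotP \<subseteq> dP I \<times> dP I \<and> sym (rel I BotP) \<and>
     (\<forall>p q r. (p, q) \<in> rel I BotP \<and> (r, p) \<in> rel I Sp \<longrightarrow> (r, q) \<in> rel I BotP) \<and>
     (\<forall>p. (p, p) \<in> rel I BotP \<longrightarrow> (\<forall>q\<in>dP I. (p, q) \<in> rel I BotP)) \<and>
     (\<forall>p q c d. (p, c) \<in> rel I Dom \<and> (q, d) \<in> rel I Dom \<and> (c, d) \<in> rel I BotC \<longrightarrow>
        (p, q) \<in> rel I BotP) \<and>
     (\<forall>p q c d. (p, c) \<in> rel I Rng \<and> (q, d) \<in> rel I Rng \<and> (c, d) \<in> rel I BotC \<longrightarrow>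
        (p, q) \<in> rel I BotP)"

definition satisfies ::
    "('u, 'pl, 'tl) interp \<Rightarrow> ('u, 'pl, 'tl) triple set \<Rightarrow> bool" (infix \<open>\<tturnstile>\<close> 50) where
  "I \<tturnstile> G \<longleftrightarrow>
     rdf_voc \<union> uni G \<subseteq> voc I \<and>
     (\<forall>(s, p, o')\<in>G. den I p \<in> dP I \<and> (den I s, den I o') \<in> rel I p) \<and>
     (\<forall>e\<in>rdf_voc. den I e \<in> dP I) \<and>
     sp_sc_conditions I \<and> typing_conditions I \<and> disjointness_conditions I"


section \<open>Ranked models\<close>

definition vocabulary :: "('u, 'pl, 'tl) dgraph \<Rightarrow> ('u, 'pl, 'tl) rdf_term set" where
  "vocabulary G = rdf_voc \<union> uni (strict_version G)"

definition delta_R :: "('u, 'pl, 'tl) dgraph \<Rightarrow> ('u, 'pl, 'tl) rdf_term set" where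
  "delta_R G = uni (strict_version G) \<union> rdf_voc"

definition delta_P :: "('u, 'pl, 'tl) dgraph \<Rightarrow> ('u, 'pl, 'tl) rdf_term set" where
  "delta_P G = rdf_voc \<union> {p \<in> uni (strict_version G). \<exists>x y.
     (x, p, y) \<in> Cl (strict_version G) \<or>
     (p, Sp, x) \<in> Cl (strict_version G) \<or> (x, Sp, p) \<in> Cl (strict_version G) \<or>
     (p, BotP, x) \<in> Cl (strict_version G) \<or> (x, BotP, p) \<in> Cl (strict_version G) \<or>
     (p, Dom, x) \<in> Cl (strict_version G) \<or> (p, Rng, x) \<in> Cl (strict_version G)}"

text \<open>
  The terms in class position are collected from \<open>delta_R G\<close>, not just from the terms occurring in
  the graph. A reserved word gets into class position only through rule \<open>r5c\<close>: as soon as some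
  \<open>(a, \<bottom>\<^sub>c, a)\<close> is in the closure, every resource is a class. If reserved words that do not occur in
  the graph were left out here, \<open>r5c\<close> would not be sound, because a term of the graph may denote
  such a word.
\<close>

definition delta_C :: "('u, 'pl, 'tl) dgraph \<Rightarrow> ('u, 'pl, 'tl) rdf_term set" where
  "delta_C G = {c \<in> delta_R G. \<exists>x.
     (x, Typ, c) \<in> Cl (strict_version G) \<or>
     (x, Dom, c) \<in> Cl (strict_version G) \<or> (x, Rng, c) \<in> Cl (strict_version G) \<or>
     (c, Sc, x) \<in> Cl (strict_version G) \<or> (x, Sc, c) \<in> Cl (strict_version G) \<or>
     (c, BotC, x) \<in> Cl (strict_version G) \<or> (x, BotC, c) \<in> Cl (strict_version G)}"

definition delta_L :: "('u, 'pl, 'tl) dgraph \<Rightarrow> ('u, 'pl, 'tl) rdf_term set" where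
  "delta_L G = uni (strict_version G) \<inter> literals"

definition interps :: "('u, 'pl, 'tl) dgraph \<Rightarrow> ('u, 'pl, 'tl) interp set" where
  "interps G = {I. interpretation_over (vocabulary G) I \<and>
     dR I = delta_R G \<and> dP I = delta_P G \<and> dC I = delta_C G \<and> dL I = delta_L G}"

text \<open>
  A ranked interpretation \<open>(\<M>, r)\<close> is given by \<open>r\<close> alone, since \<open>\<M>\<close> is determined by the graph;
  \<open>r\<close> is \<open>undefined\<close> outside \<open>\<M>\<close>.
\<close>

type_synonym ('u, 'pl, 'tl) ranking = "('u, 'pl, 'tl) interp \<Rightarrow> enat"

definition ranked_interp :: "('u, 'pl, 'tl) dgraph \<Rightarrow> ('u, 'pl, 'tl) ranking \<Rightarrow> bool" where
  "ranked_interp G r \<longleftrightarrow>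
     r \<in> extensional (interps G) \<and>
     0 \<in> r ` interps G \<and>
     (\<forall>i::nat. i > 0 \<and> enat i \<in> r ` interps G \<longrightarrow> enat (i - 1) \<in> r ` interps G)"

definition finite_ranked ::
    "('u, 'pl, 'tl) dgraph \<Rightarrow> ('u, 'pl, 'tl) ranking \<Rightarrow> ('u, 'pl, 'tl) interp set" where
  "finite_ranked G r = {I \<in> interps G. r I < \<infinity>}"

definition cmin :: "('u, 'pl, 'tl) dgraph \<Rightarrow> ('u, 'pl, 'tl) rdf_term \<Rightarrow>
    ('u, 'pl, 'tl) ranking \<Rightarrow> ('u, 'pl, 'tl) interp set" where
  "cmin G t r = {I \<in> finite_ranked G r. \<not> I \<tturnstile> {(t, BotC, t)} \<and>
     (\<forall>J\<in>finite_ranked G r. \<not> J \<tturnstile> {(t, BotC, t)} \<longrightarrow> r I \<le> r J)}"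

definition pmin :: "('u, 'pl, 'tl) dgraph \<Rightarrow> ('u, 'pl, 'tl) rdf_term \<Rightarrow>
    ('u, 'pl, 'tl) ranking \<Rightarrow> ('u, 'pl, 'tl) interp set" where
  "pmin G t r = {I \<in> finite_ranked G r. \<not> I \<tturnstile> {(t, BotP, t)} \<and>
     (\<forall>J\<in>finite_ranked G r. \<not> J \<tturnstile> {(t, BotP, t)} \<longrightarrow> r I \<le> r J)}"

definition ranked_sat ::
    "('u, 'pl, 'tl) dgraph \<Rightarrow> ('u, 'pl, 'tl) ranking \<Rightarrow> ('u, 'pl, 'tl) triple \<Rightarrow> bool" where
  "ranked_sat G r t \<longleftrightarrow> (\<forall>I\<in>finite_ranked G r. I \<tturnstile> {t})"

definition ranked_dsat ::
    "('u, 'pl, 'tl) dgraph \<Rightarrow> ('u, 'pl, 'tl) ranking \<Rightarrow> ('u, 'pl, 'tl) dtriple \<Rightarrow> bool" where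
  "ranked_dsat G r d \<longleftrightarrow>
     (\<forall>a b. d = \<langle>a, Sc, b\<rangle> \<longrightarrow> (\<forall>I\<in>cmin G a r. I \<tturnstile> {(a, Sc, b)})) \<and>
     (\<forall>a b. d = \<langle>a, Sp, b\<rangle> \<longrightarrow> (\<forall>I\<in>pmin G a r. I \<tturnstile> {(a, Sp, b)}))"

definition ranked_model :: "('u, 'pl, 'tl) dgraph \<Rightarrow> ('u, 'pl, 'tl) ranking \<Rightarrow> bool" where
  "ranked_model G r \<longleftrightarrow> ranked_interp G r \<and>
     (\<forall>t\<in>str_part G. ranked_sat G r t) \<and> (\<forall>d\<in>def_part G. ranked_dsat G r d)"

definition rank_le ::
    "('u, 'pl, 'tl) dgraph \<Rightarrow> ('u, 'pl, 'tl) ranking \<Rightarrow> ('u, 'pl, 'tl) ranking \<Rightarrow> bool" where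
  "rank_le G r r' \<longleftrightarrow> (\<forall>I\<in>interps G. r I \<le> r' I)"

definition minimal_ranked_model ::
    "('u, 'pl, 'tl) dgraph \<Rightarrow> ('u, 'pl, 'tl) ranking \<Rightarrow> bool" where
  "minimal_ranked_model G r \<longleftrightarrow> ranked_model G r \<and>
     (\<forall>r'. ranked_model G r' \<and> rank_le G r' r \<longrightarrow> r' = r)"

definition min_ranked_model :: "('u, 'pl, 'tl) dgraph \<Rightarrow> ('u, 'pl, 'tl) ranking" where
  "min_ranked_model G = (THE r. minimal_ranked_model G r)"

definition min_entails ::
    "('u, 'pl, 'tl) dgraph \<Rightarrow> ('u, 'pl, 'tl) triple \<Rightarrow> bool" (infix \<open>\<Turnstile>\<^sub>m\<^sub>i\<^sub>n\<close> 50) where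
  "G \<Turnstile>\<^sub>m\<^sub>i\<^sub>n t \<longleftrightarrow> ranked_sat G (min_ranked_model G) t"


section \<open>Procedures\<close>

fun D_seq :: "('u, 'pl, 'tl) dgraph \<Rightarrow> nat \<Rightarrow> ('u, 'pl, 'tl) dtriple set" where
  "D_seq G 0 = def_part G"
| "D_seq G (Suc i) =
     {\<langle>p, Sc, q\<rangle> | p q. \<langle>p, Sc, q\<rangle> \<in> D_seq G i \<and>
        str_part G \<union> strictify ` D_seq G i \<turnstile> (p, BotC, p)} \<union>
     {\<langle>p, Sp, q\<rangle> | p q. \<langle>p, Sp, q\<rangle> \<in> D_seq G i \<and>
        str_part G \<union> strictify ` D_seq G i \<turnstile> (p, BotP, p)}"

text \<open>The output \<open>{D\<^sub>0, \<dots>, D\<^sub>n, D\<^sub>\<infinity>}\<close> is represented by the list \<open>[D\<^sub>0, \<dots>, D\<^sub>n]\<close> paired with \<open>D\<^sub>\<infinity>\<close>.\<close>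

definition Ranking :: "('u, 'pl, 'tl) dgraph \<Rightarrow>
    ('u, 'pl, 'tl) dtriple set list \<times> ('u, 'pl, 'tl) dtriple set" where
  "Ranking G = (let n = (LEAST n. D_seq G n = D_seq G (Suc n))
                in (map (D_seq G) [0..<Suc n], D_seq G n))"

definition StrictMinEntailment :: "('u, 'pl, 'tl) dgraph \<Rightarrow>
    ('u, 'pl, 'tl) dtriple set list \<times> ('u, 'pl, 'tl) dtriple set \<Rightarrow>
    ('u, 'pl, 'tl) triple \<Rightarrow> bool" where
  "StrictMinEntailment G rk t \<longleftrightarrow>
     str_part G \<union> {(a, BotC, a) | a b. \<langle>a, Sc, b\<rangle> \<in> snd rk}
                \<union> {(a, BotP, a) | a b. \<langle>a, Sp, b\<rangle> \<in> snd rk} \<turnstile> t"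

end

theory Submission
  imports Defs
begin

text \<open>
  The least ranked model is obtained by layering: \<open>layers G k\<close> collects the interpretations of rank
  below \<open>k\<close>, and an interpretation enters the next layer as soon as it respects every defeasible
  triple whose subject is still empty in all lower layers.
  A triple in \<open>D\<^sub>\<infinity>\<close> never leaves this exceptional status: if an interpretation satisfies the
  strict part and satisfies each defeasible triple of \<open>D\<^sub>\<infinity>\<close> or makes its subject empty, then it
  makes all these subjects empty, because an unsatisfied \<open>sc\<close>- or \<open>sp\<close>-premise of a derivation of
  a disjointness triple can be traded for the emptiness of its subject.
  Conversely, the canonical model of \<open>G\<^sup>s\<^sup>t\<^sup>r \<union> D\<^sub>i\<^sup>s\<close> has rank at most \<open>i\<close>, hence the canonical
  model of the graph queried by the procedure has finite rank.
\<close>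

section \<open>Closure\<close>

text \<open>Asking only for \<open>G \<subseteq> Cl H\<close> covers monotonicity and also cut:
  triples already derivable may be dropped from the premises.\<close>

lemma Cl_mono: "t \<in> Cl G \<Longrightarrow> G \<subseteq> Cl H \<Longrightarrow> t \<in> Cl H"
  by (induction rule: Cl.induct) (blast intro: Cl.intros)+

lemma uni_mono: "A \<subseteq> B \<Longrightarrow> uni A \<subseteq> uni B"
  by (auto simp: uni_def)

text \<open>
  Only the rules \<open>r5c\<close> and \<open>r6c\<close> can bring new terms or reserved words into subject or object
  position.
\<close>

lemma Cl_terms_aux:
  assumes "t \<in> Cl H" and "\<forall>t\<in>H. is_triple t"
  shows "fst (snd t) \<notin> {BotC, BotP} \<Longrightarrow> fst t \<in> uni H - rdf_voc \<and> snd (snd t) \<in> uni H - rdf_voc"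
  using assms(1)
proof (induction rule: Cl.induct)
  case (base t)
  then show ?case using assms(2) by (cases t) (force simp: uni_def is_triple_def)
\<comment> \<open>In \<open>r2b\<close>, \<open>r4a\<close> and \<open>r4b\<close> the hypothesis
  for the first premise makes \<open>D\<close> unreserved, so the hypothesis for
  \<open>(X, D, Y)\<close> applies.\<close>
qed (auto simp: rdf_voc_def)

lemma Cl_terms:
  assumes "(s, p, q) \<in> Cl H" and "\<forall>t\<in>H. is_triple t" and "p \<notin> {BotC, BotP}"
  shows "s \<in> uni H" "s \<notin> rdf_voc" "q \<in> uni H" "q \<notin> rdf_voc"
  using Cl_terms_aux[OF assms(1,2)] assms(3) by auto

lemma Cl_predicate:
  assumes "(s, p, q) \<in> Cl H" and "\<forall>t\<in>H. is_triple t"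
  shows "p \<in> uni H \<union> rdf_voc"
  using assms(1)
proof (cases rule: Cl.cases)
  case base
  then show ?thesis by (force simp: uni_def)
next
  case (r2b D)
  then show ?thesis using Cl_terms(3)[OF r2b(1) assms(2)] by simp
qed (auto simp: rdf_voc_def)

text \<open>Only \<open>r2b\<close> could produce such a triple, and its \<open>Sp\<close>-premise
  would then have a reserved object. Defeasible triples have other predicates, so domain and range
  information is always strict.\<close>

lemma Cl_Dom_Rng:
  assumes "(s, p, q) \<in> Cl H" and "\<forall>t\<in>H. is_triple t" and "p \<in> {Dom, Rng}"
  shows "(s, p, q) \<in> H"
  using assms(1)
proof (cases rule: Cl.cases)
  case (r2b D)
  then show ?thesis using Cl_terms(4)[OF r2b(1) assms(2)] assms(3) by (auto simp: rdf_voc_def)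
qed (use assms(3) in auto)


section \<open>Soundness\<close>

lemma satisfies_triple:
  "I \<tturnstile> {(s, p, q)} \<longleftrightarrow>
     I \<tturnstile> {} \<and> {s, p, q} \<subseteq> voc I \<and> den I p \<in> dP I \<and> (den I s, den I q) \<in> rel I p"
  by (auto simp: satisfies_def uni_def)

lemma satisfies_empty:
  "I \<tturnstile> {} \<longleftrightarrow> rdf_voc \<subseteq> voc I \<and> (\<forall>e\<in>rdf_voc. den I e \<in> dP I) \<and>
     sp_sc_conditions I \<and> typing_conditions I \<and> disjointness_conditions I"
  by (auto simp: satisfies_def uni_def)

lemma satisfies_reserved:
  assumes "p \<in> rdf_voc"
  shows "I \<tturnstile> {(s, p, q)} \<longleftrightarrow>
     I \<tturnstile> {} \<and> s \<in> voc I \<and> q \<in> voc I \<and> (den I s, den I q) \<in> rel I p"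
  using assms by (auto simp: satisfies_triple satisfies_empty)

lemmas satisfies_voc =
  satisfies_reserved[of Sp, simplified rdf_voc_def, simplified]
  satisfies_reserved[of Sc, simplified rdf_voc_def, simplified]
  satisfies_reserved[of Typ, simplified rdf_voc_def, simplified]
  satisfies_reserved[of Dom, simplified rdf_voc_def, simplified]
  satisfies_reserved[of Rng, simplified rdf_voc_def, simplified]
  satisfies_reserved[of BotC, simplified rdf_voc_def, simplified]
  satisfies_reserved[of BotP, simplified rdf_voc_def, simplified]

section \<open>Soundness of the single rules\<close>

context
  fixes I :: "('u, 'pl, 'tl) interp"
begin

lemma sp_conditions:
  assumes "I \<tturnstile> {}" and "(p, q) \<in> rel I Sp"
  shows "p \<in> dP I" "q \<in> dP I" "pext I p \<subseteq> pext I q"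
  using assms by (auto simp: satisfies_empty sp_sc_conditions_def)

lemma sc_conditions:
  assumes "I \<tturnstile> {}" and "(c, d) \<in> rel I Sc"
  shows "c \<in> dC I" "d \<in> dC I" "cext I c \<subseteq> cext I d"
  using assms by (auto simp: satisfies_empty sp_sc_conditions_def)

lemma cext_iff:
  assumes "I \<tturnstile> {}" and "c \<in> dC I"
  shows "x \<in> cext I c \<longleftrightarrow> (x, c) \<in> rel I Typ"
  using assms by (auto simp: satisfies_empty typing_conditions_def)

lemma dom_conditions:
  assumes "I \<tturnstile> {}" and "(p, c) \<in> rel I Dom" and "(x, y) \<in> pext I p"
  shows "(x, c) \<in> rel I Typ"
  using assms(2,3) cext_iff[OF assms(1)] assms(1)
  by (force simp: satisfies_empty typing_conditions_def)

lemma rng_conditions: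
  assumes "I \<tturnstile> {}" and "(p, c) \<in> rel I Rng" and "(x, y) \<in> pext I p"
  shows "(y, c) \<in> rel I Typ"
  using assms(2,3) cext_iff[OF assms(1)] assms(1)
  by (force simp: satisfies_empty typing_conditions_def)

lemma sound_2a:
  assumes "I \<tturnstile> {(A, Sp, B)}" and "I \<tturnstile> {(B, Sp, C)}"
  shows "I \<tturnstile> {(A, Sp, C)}"
proof -
  have I: "I \<tturnstile> {}" and rels: "(den I A, den I B) \<in> rel I Sp" "(den I B, den I C) \<in> rel I Sp"
    using assms by (auto simp: satisfies_voc)
  have "trans_on (dP I) (rel I Sp)" using I by (simp add: satisfies_empty sp_sc_conditions_def)
  from trans_onD[OF this _ _ _ rels] have "(den I A, den I C) \<in> rel I Sp"
    using sp_conditions[OF I rels(1)] sp_conditions[OF I rels(2)] by blast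
  then show ?thesis using assms by (simp add: satisfies_voc)
qed

lemma sound_2b: "I \<tturnstile> {(D, Sp, E)} \<Longrightarrow> I \<tturnstile> {(X, D, Y)} \<Longrightarrow> I \<tturnstile> {(X, E, Y)}"
  using sp_conditions[of "den I D" "den I E"]
  by (auto simp: satisfies_triple rel_def)

lemma sound_3a:
  assumes "I \<tturnstile> {(A, Sc, B)}" and "I \<tturnstile> {(B, Sc, C)}"
  shows "I \<tturnstile> {(A, Sc, C)}"
proof -
  have I: "I \<tturnstile> {}" and rels: "(den I A, den I B) \<in> rel I Sc" "(den I B, den I C) \<in> rel I Sc"
    using assms by (auto simp: satisfies_voc)
  have "trans_on (dC I) (rel I Sc)" using I by (simp add: satisfies_empty sp_sc_conditions_def)
  from trans_onD[OF this _ _ _ rels] have "(den I A, den I C) \<in> rel I Sc"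
    using sc_conditions[OF I rels(1)] sc_conditions[OF I rels(2)] by blast
  then show ?thesis using assms by (simp add: satisfies_voc)
qed

lemma sound_3b: "I \<tturnstile> {(A, Sc, B)} \<Longrightarrow> I \<tturnstile> {(X, Typ, A)} \<Longrightarrow> I \<tturnstile> {(X, Typ, B)}"
  using sc_conditions[of "den I A" "den I B"] cext_iff[of _ "den I X"]
  by (auto simp: satisfies_voc)

lemma sound_4a: "I \<tturnstile> {(D, Dom, B)} \<Longrightarrow> I \<tturnstile> {(X, D, Y)} \<Longrightarrow> I \<tturnstile> {(X, Typ, B)}"
  using dom_conditions[of "den I D" "den I B"]
  by (auto simp: satisfies_voc satisfies_triple[of I X D] rel_def[of I D])

lemma sound_4b: "I \<tturnstile> {(D, Rng, B)} \<Longrightarrow> I \<tturnstile> {(X, D, Y)} \<Longrightarrow> I \<tturnstile> {(Y, Typ, B)}"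
  using rng_conditions[of "den I D" "den I B"]
  by (auto simp: satisfies_voc satisfies_triple[of I X D] rel_def[of I D])

lemma BotC_conditions:
  assumes "I \<tturnstile> {}"
  shows "(c, d) \<in> rel I BotC \<Longrightarrow> d \<in> dC I"
    and "(c, d) \<in> rel I BotC \<Longrightarrow> (d, c) \<in> rel I BotC"
    and "(c, d) \<in> rel I BotC \<Longrightarrow> (e, c) \<in> rel I Sc \<Longrightarrow> (e, d) \<in> rel I BotC"
    and "(c, c) \<in> rel I BotC \<Longrightarrow> d \<in> dC I \<Longrightarrow> (c, d) \<in> rel I BotC"
proof -
  have *: "disjointness_conditions I" using assms by (simp add: satisfies_empty)
  show "(c, d) \<in> rel I BotC \<Longrightarrow> d \<in> dC I"
    using * unfolding disjointness_conditions_def by blast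
  have "sym (rel I BotC)" using * unfolding disjointness_conditions_def by iprover
  then show "(c, d) \<in> rel I BotC \<Longrightarrow> (d, c) \<in> rel I BotC" by (rule symD)
  show "(c, d) \<in> rel I BotC \<Longrightarrow> (e, c) \<in> rel I Sc \<Longrightarrow> (e, d) \<in> rel I BotC"
    using * unfolding disjointness_conditions_def by iprover
  show "(c, c) \<in> rel I BotC \<Longrightarrow> d \<in> dC I \<Longrightarrow> (c, d) \<in> rel I BotC"
    using * unfolding disjointness_conditions_def by blast
qed

lemma sound_5a: "I \<tturnstile> {(A, BotC, B)} \<Longrightarrow> I \<tturnstile> {(B, BotC, A)}"
  unfolding satisfies_voc by (blast intro: BotC_conditions(2))

lemma sound_5b: "I \<tturnstile> {(A, BotC, B)} \<Longrightarrow> I \<tturnstile> {(C, Sc, A)} \<Longrightarrow> I \<tturnstile> {(C, BotC, B)}"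
  unfolding satisfies_voc by (blast intro: BotC_conditions(3))

text \<open>Semantically an empty class is disjoint only from the members of \<open>dC I\<close>,
  whereas \<open>r5c\<close> allows any \<open>B\<close>; the premises on \<open>B\<close> close
  this gap.\<close>

lemma sound_5c: "I \<tturnstile> {(A, BotC, A)} \<Longrightarrow> B \<in> voc I \<Longrightarrow> den I B \<in> dC I \<Longrightarrow> I \<tturnstile> {(A, BotC, B)}"
  unfolding satisfies_voc by (blast intro: BotC_conditions(4))

lemma BotC_in_dC: "I \<tturnstile> {(A, BotC, B)} \<Longrightarrow> den I B \<in> dC I"
  unfolding satisfies_voc by (blast intro: BotC_conditions(1))

lemma BotP_conditions:
  assumes "I \<tturnstile> {}"
  shows "(c, d) \<in> rel I BotP \<Longrightarrow> d \<in> dP I"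
    and "(c, d) \<in> rel I BotP \<Longrightarrow> (d, c) \<in> rel I BotP"
    and "(c, d) \<in> rel I BotP \<Longrightarrow> (e, c) \<in> rel I Sp \<Longrightarrow> (e, d) \<in> rel I BotP"
    and "(c, c) \<in> rel I BotP \<Longrightarrow> d \<in> dP I \<Longrightarrow> (c, d) \<in> rel I BotP"
proof -
  have *: "disjointness_conditions I" using assms by (simp add: satisfies_empty)
  show "(c, d) \<in> rel I BotP \<Longrightarrow> d \<in> dP I"
    using * unfolding disjointness_conditions_def by blast
  have "sym (rel I BotP)" using * unfolding disjointness_conditions_def by iprover
  then show "(c, d) \<in> rel I BotP \<Longrightarrow> (d, c) \<in> rel I BotP" by (rule symD)
  show "(c, d) \<in> rel I BotP \<Longrightarrow> (e, c) \<in> rel I Sp \<Longrightarrow> (e, d) \<in> rel I BotP"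
    using * unfolding disjointness_conditions_def by iprover
  show "(c, c) \<in> rel I BotP \<Longrightarrow> d \<in> dP I \<Longrightarrow> (c, d) \<in> rel I BotP"
    using * unfolding disjointness_conditions_def by blast
qed

lemma sound_6a: "I \<tturnstile> {(A, BotP, B)} \<Longrightarrow> I \<tturnstile> {(B, BotP, A)}"
  unfolding satisfies_voc by (blast intro: BotP_conditions(2))

lemma sound_6b: "I \<tturnstile> {(A, BotP, B)} \<Longrightarrow> I \<tturnstile> {(C, Sp, A)} \<Longrightarrow> I \<tturnstile> {(C, BotP, B)}"
  unfolding satisfies_voc by (blast intro: BotP_conditions(3))

lemma sound_6c: "I \<tturnstile> {(A, BotP, A)} \<Longrightarrow> B \<in> voc I \<Longrightarrow> den I B \<in> dP I \<Longrightarrow> I \<tturnstile> {(A, BotP, B)}"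
  unfolding satisfies_voc by (blast intro: BotP_conditions(4))

lemma BotP_in_dP: "I \<tturnstile> {(A, BotP, B)} \<Longrightarrow> den I B \<in> dP I"
  unfolding satisfies_voc by (blast intro: BotP_conditions(1))

lemma sound_7a:
  assumes "I \<tturnstile> {(A, Dom, C)}" and "I \<tturnstile> {(B, Dom, D)}" and "I \<tturnstile> {(C, BotC, D)}"
  shows "I \<tturnstile> {(A, BotP, B)}"
proof -
  have "disjointness_conditions I" using assms(1) by (simp add: satisfies_voc satisfies_empty)
  then have "\<forall>p q c d. (p, c) \<in> rel I Dom \<and> (q, d) \<in> rel I Dom \<and> (c, d) \<in> rel I BotC \<longrightarrow>
      (p, q) \<in> rel I BotP"
    unfolding disjointness_conditions_def by (elim conjE)
  then have "(den I A, den I B) \<in> rel I BotP"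
    using assms unfolding satisfies_voc by blast
  then show ?thesis using assms by (simp add: satisfies_voc)
qed

lemma sound_7b:
  assumes "I \<tturnstile> {(A, Rng, C)}" and "I \<tturnstile> {(B, Rng, D)}" and "I \<tturnstile> {(C, BotC, D)}"
  shows "I \<tturnstile> {(A, BotP, B)}"
proof -
  have "disjointness_conditions I" using assms(1) by (simp add: satisfies_voc satisfies_empty)
  then have "\<forall>p q c d. (p, c) \<in> rel I Rng \<and> (q, d) \<in> rel I Rng \<and> (c, d) \<in> rel I BotC \<longrightarrow>
      (p, q) \<in> rel I BotP"
    unfolding disjointness_conditions_def by (elim conjE)
  then have "(den I A, den I B) \<in> rel I BotP"
    using assms unfolding satisfies_voc by blast
  then show ?thesis using assms by (simp add: satisfies_voc)
qed

end

text \<open>\<open>r5c\<close> and \<open>r6c\<close> introduce arbitrary terms: \<open>c\<close>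
  and \<open>p\<close> make every denotation a class or a property once these rules apply, and the
  premise on \<open>uni {t}\<close> excludes terms without denotation. This premise passes upwards
  in a derivation, since a term that disappears in a conclusion is reserved or is the subject or
  object of a premise that is not a disjointness triple, hence in \<open>uni H\<close>.\<close>

lemma Cl_sound:
  assumes "t \<in> Cl H" and "\<forall>t\<in>H. is_triple t" and "\<forall>t\<in>H. I \<tturnstile> {t}" and "uni H \<subseteq> voc I"
    and c: "\<And>A. (A, BotC, A) \<in> Cl H \<Longrightarrow> den I ` voc I \<subseteq> dC I"
    and p: "\<And>A. (A, BotP, A) \<in> Cl H \<Longrightarrow> den I ` voc I \<subseteq> dP I"
  shows "uni {t} \<subseteq> voc I \<Longrightarrow> I \<tturnstile> {t}"
  using assms(1)
proof (induction rule: Cl.induct)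
  note terms = Cl_terms[OF _ assms(2)]
  have voc: "s \<in> voc I" "q \<in> voc I" if "(s, p, q) \<in> Cl H" "p \<notin> {BotC, BotP}" for s p q
    using terms[OF that] assms(4) by auto
  \<comment> \<open>A derivation starts from triples of \<open>H\<close>, whose satisfaction puts
    the reserved words into the vocabulary.\<close>
  have pred: "rdf_voc \<subseteq> voc I" if "t \<in> Cl H" for t
    using that by (induction rule: Cl.induct) (use assms(3) in \<open>auto simp: satisfies_def\<close>)
  have reserved: "p \<in> voc I" if "(s, p, q) \<in> Cl H" for s p q
    using Cl_predicate[OF that assms(2)] pred[OF that] assms(4) by auto
  {
    case (base t)
    then show ?case using assms(3) by blast
  next
    case (r2a A B C)
    then show ?case using sound_2a[of I A B C] voc[OF r2a.hyps(1)] by (auto simp: uni_def)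
  next
    case (r2b D E X Y)
    have "D \<notin> rdf_voc" using terms(2)[OF r2b.hyps(1)] by simp
    then have "D \<notin> {BotC, BotP}" by (auto simp: rdf_voc_def)
    then show ?case using r2b sound_2b[of I D E X Y] voc[OF r2b.hyps(1)] voc[OF r2b.hyps(2)]
        reserved[OF r2b.hyps(1)]
      by (auto simp: uni_def)
  next
    case (r3a A B C)
    then show ?case using sound_3a[of I A B C] voc[OF r3a.hyps(1)] by (auto simp: uni_def)
  next
    case (r3b A B X)
    then show ?case using sound_3b[of I A B X] voc[OF r3b.hyps(1)] reserved[OF r3b.hyps(1)]
      by (auto simp: uni_def)
  next
    case (r4a D B X Y)
    have "D \<notin> rdf_voc" using terms(2)[OF r4a.hyps(1)] by simp
    then have "D \<notin> {BotC, BotP}" by (auto simp: rdf_voc_def)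
    then show ?case using r4a sound_4a[of I D B X Y] voc[OF r4a.hyps(1)] voc[OF r4a.hyps(2)]
        reserved[OF r4a.hyps(1)]
      by (auto simp: uni_def)
  next
    case (r4b D B X Y)
    have "D \<notin> rdf_voc" using terms(2)[OF r4b.hyps(1)] by simp
    then have "D \<notin> {BotC, BotP}" by (auto simp: rdf_voc_def)
    then show ?case using r4b sound_4b[of I D B X Y] voc[OF r4b.hyps(1)] voc[OF r4b.hyps(2)]
        reserved[OF r4b.hyps(1)]
      by (auto simp: uni_def)
  next
    case (r5a A B)
    then show ?case using sound_5a[of I A B] by (auto simp: uni_def)
  next
    case (r5b A B C)
    then show ?case using sound_5b[of I A B C] voc[OF r5b.hyps(2)] reserved[OF r5b.hyps(2)]
      by (auto simp: uni_def)
  next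
    case (r5c A B)
    then show ?case using sound_5c[of I A B] c[OF r5c.hyps(1)] by (auto simp: uni_def)
  next
    case (r6a A B)
    then show ?case using sound_6a[of I A B] by (auto simp: uni_def)
  next
    case (r6b A B C)
    then show ?case using sound_6b[of I A B C] voc[OF r6b.hyps(2)] reserved[OF r6b.hyps(2)]
      by (auto simp: uni_def)
  next
    case (r6c A B)
    then show ?case using sound_6c[of I A B] p[OF r6c.hyps(1)] by (auto simp: uni_def)
  next
    case (r7a A C B D)
    then show ?case using sound_7a[of I A C B D] voc[OF r7a.hyps(1)] voc[OF r7a.hyps(2)]
        reserved[OF r7a.hyps(1)] reserved[OF r7a.hyps(3)]
      by (auto simp: uni_def)
  next
    case (r7b A C B D)
    then show ?case using sound_7b[of I A C B D] voc[OF r7b.hyps(1)] voc[OF r7b.hyps(2)]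
        reserved[OF r7b.hyps(1)] reserved[OF r7b.hyps(3)]
      by (auto simp: uni_def)
  }
qed

text \<open>Emptiness of the subject, as a class for \<open>Sc\<close> and as a property in the
  remaining case \<open>Sp\<close>. Both kinds of defeasible triples can thus be treated at
  once.\<close>

fun bot_triple :: "('u, 'pl, 'tl) dtriple \<Rightarrow> ('u, 'pl, 'tl) triple" where
  "bot_triple \<langle>a, p, b\<rangle> = (a, if p = Sc then BotC else BotP, a)"

lemma is_triple_strictify: "is_dtriple d \<Longrightarrow> is_triple (strictify d)"
  by (cases d) (auto simp: is_triple_def uris_def rdf_voc_def)

lemma is_triple_bot: "is_dtriple d \<Longrightarrow> is_triple (bot_triple d)"
  by (cases d) (auto simp: is_triple_def uris_def rdf_voc_def)

lemma uni_bot: "uni {bot_triple d} \<subseteq> uni {strictify d} \<union> rdf_voc"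
  by (cases d) (auto simp: uni_def rdf_voc_def)

text \<open>
  Derivations of disjointness triples survive if some of the defeasible premises are replaced by
  the emptiness of their subjects.
\<close>

lemma Cl_disjointness_sound:
  fixes S :: "('u, 'pl, 'tl) triple set" and D :: "('u, 'pl, 'tl) dtriple set"
  defines "H \<equiv> S \<union> strictify ` D"
  assumes "t \<in> Cl H" and S: "\<forall>t\<in>S. is_triple t" and D: "\<forall>d\<in>D. is_dtriple d"
    and SI: "\<forall>t\<in>S. I \<tturnstile> {t}" and DI: "\<forall>d\<in>D. I \<tturnstile> {bot_triple d} \<or> I \<tturnstile> {strictify d}"
    and "uni H \<subseteq> voc I"
    and c: "\<And>A. (A, BotC, A) \<in> Cl H \<Longrightarrow> den I ` voc I \<subseteq> dC I"
    and p: "\<And>A. (A, BotP, A) \<in> Cl H \<Longrightarrow> den I ` voc I \<subseteq> dP I"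
  shows "case t of (s, p, q) \<Rightarrow>
      (p = Sc \<longrightarrow> I \<tturnstile> {t} \<or> I \<tturnstile> {(s, BotC, s)}) \<and>
      (p = Sp \<longrightarrow> I \<tturnstile> {t} \<or> I \<tturnstile> {(s, BotP, s)}) \<and>
      (p \<in> {BotC, BotP} \<and> s \<in> voc I \<and> q \<in> voc I \<longrightarrow> I \<tturnstile> {t})"
  using assms(2)
proof (induction rule: Cl.induct)
  \<comment> \<open>The other predicates may stay open: disjointness triples rest on
    \<open>Sc\<close>-, \<open>Sp\<close>- and disjointness triples, and on domain and range
    triples, which come from \<open>S\<close>.\<close>
  have H: "\<forall>t\<in>H. is_triple t"
    using S D is_triple_strictify unfolding H_def by blast
  have voc: "s \<in> voc I" "q \<in> voc I" if "(s, p, q) \<in> Cl H" "p \<notin> {BotC, BotP}" for s p q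
    using Cl_terms[OF that(1) H that(2)] assms(7) by auto
  have strict: "I \<tturnstile> {(s, p, q)}" if "(s, p, q) \<in> Cl H" "p \<in> {Dom, Rng}" for s p q
  proof -
    have "(s, p, q) \<notin> strictify ` D"
    proof
      assume "(s, p, q) \<in> strictify ` D"
      then obtain d where "d \<in> D" "strictify d = (s, p, q)" by force
      then show False using D that(2) by (cases d) auto
    qed
    then show ?thesis using Cl_Dom_Rng[OF that(1) H that(2)] SI by (auto simp: H_def)
  qed
  {
    case (base t)
    show ?case
    proof (cases "t \<in> S")
      case True
      then show ?thesis using SI by (cases t) auto
    next
      case False
      then obtain d where "d \<in> D" "t = strictify d" using base by (auto simp: H_def)
      then show ?thesis using D DI by (cases d) force
    qed
  next
    case (r2a A B C)
    consider "I \<tturnstile> {(A, BotP, A)}" | "I \<tturnstile> {(A, Sp, B)}" "I \<tturnstile> {(B, Sp, C)}"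
      | "I \<tturnstile> {(A, Sp, B)}" "I \<tturnstile> {(B, BotP, B)}"
      using r2a.IH by auto
    then show ?case
    proof cases
      case 3
      \<comment> \<open>\<open>A\<close> lies below the empty \<open>B\<close>: replace
        \<open>B\<close> by \<open>A\<close> on one side, swap, and replace the other side.\<close>
      have "I \<tturnstile> {(A, BotP, A)}" using sound_6b[OF sound_6a[OF sound_6b[OF 3(2,1)]] 3(1)] .
      then show ?thesis by simp
    qed (auto intro: sound_2a)
  next
    case (r2b D E X Y)
    have "E \<notin> rdf_voc" using Cl_terms(4)[OF r2b.hyps(1) H] by simp
    then show ?case by (auto simp: rdf_voc_def)
  next
    case (r3a A B C)
    consider "I \<tturnstile> {(A, BotC, A)}" | "I \<tturnstile> {(A, Sc, B)}" "I \<tturnstile> {(B, Sc, C)}"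
      | "I \<tturnstile> {(A, Sc, B)}" "I \<tturnstile> {(B, BotC, B)}"
      using r3a.IH by auto
    then show ?case
    proof cases
      case 3
      have "I \<tturnstile> {(A, BotC, A)}" using sound_5b[OF sound_5a[OF sound_5b[OF 3(2,1)]] 3(1)] .
      then show ?thesis by simp
    qed (auto intro: sound_3a)
  next
    case (r5a A B)
    then show ?case using sound_5a[of I A B] by auto
  next
    case (r5b A B C)
    \<comment> \<open>If the \<open>Sc\<close>-premise has been traded, \<open>C\<close> is empty
      and so disjoint from every class; \<open>B\<close> denotes a class because the disjointness
      premise is satisfied.\<close>
    then show ?case
      using voc[OF r5b.hyps(2)] sound_5b[of I A B C] sound_5c[of I C B] BotC_in_dC[of I A B] by auto
  next
    case (r5c A B)
    then show ?case using sound_5c[of I A B] c[OF r5c.hyps(1)] by auto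
  next
    case (r6a A B)
    then show ?case using sound_6a[of I A B] by auto
  next
    case (r6b A B C)
    then show ?case
      using voc[OF r6b.hyps(2)] sound_6b[of I A B C] sound_6c[of I C B] BotP_in_dP[of I A B] by auto
  next
    case (r6c A B)
    then show ?case using sound_6c[of I A B] p[OF r6c.hyps(1)] by auto
  next
    case (r7a A C B D)
    then show ?case
      using voc[OF r7a.hyps(1)] voc[OF r7a.hyps(2)] strict[OF r7a.hyps(1)] strict[OF r7a.hyps(2)]
        sound_7a[of I A C B D] by auto
  next
    case (r7b A C B D)
    then show ?case
      using voc[OF r7b.hyps(1)] voc[OF r7b.hyps(2)] strict[OF r7b.hyps(1)] strict[OF r7b.hyps(2)]
        sound_7b[of I A C B D] by auto
  }
qed auto

section \<open>Interpretations over the domains fixed by the graph\<close>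

lemma delta_P_subset: "delta_P G \<subseteq> delta_R G"
  by (auto simp: delta_P_def delta_R_def)

lemma interps_den:
  assumes "I \<in> interps G"
  shows "voc I = delta_R G" "den I ` voc I \<subseteq> delta_R G"
  using assms delta_P_subset[of G]
  by (fastforce simp: interps_def interpretation_over_def vocabulary_def delta_R_def)+

text \<open>Once \<open>(A, BotC, A)\<close> is derivable, \<open>r5c\<close> puts every term in
  class position, so \<open>delta_C G\<close> exhausts the resources; \<open>r6c\<close> does the
  same for \<open>delta_P G\<close>. This supplies \<open>c\<close> and \<open>p\<close> of the
  soundness lemmas.\<close>

lemma interps_total:
  assumes "I \<in> interps G"
  shows "(A, BotC, A) \<in> Cl (strict_version G) \<Longrightarrow> den I ` voc I \<subseteq> dC I"
    and "(A, BotP, A) \<in> Cl (strict_version G) \<Longrightarrow> den I ` voc I \<subseteq> dP I"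
proof -
  assume "(A, BotC, A) \<in> Cl (strict_version G)"
  then have "delta_C G = delta_R G" by (auto simp: delta_C_def intro: Cl.r5c)
  then show "den I ` voc I \<subseteq> dC I" using interps_den[OF assms] assms by (auto simp: interps_def)
next
  assume "(A, BotP, A) \<in> Cl (strict_version G)"
  then have "delta_R G \<subseteq> delta_P G" by (auto simp: delta_P_def delta_R_def intro: Cl.r6c)
  then show "den I ` voc I \<subseteq> dP I" using interps_den[OF assms] assms by (auto simp: interps_def)
qed


section \<open>Canonical models\<close>

text \<open>A term model: terms denote themselves and extensions are read off \<open>Cl H\<close>.
  The domains come from \<open>G\<close>, so that the models of different \<open>H\<close> are
  ranked together.\<close>

definition canon :: "('u, 'pl, 'tl) dgraph \<Rightarrow> ('u, 'pl, 'tl) triple set \<Rightarrow> ('u, 'pl, 'tl) interp" where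
  "canon G H = \<lparr>voc = vocabulary G, dR = delta_R G, dP = delta_P G, dC = delta_C G, dL = delta_L G,
     pext = (\<lambda>p\<in>delta_P G. {(x, y). x \<in> delta_R G \<and> y \<in> delta_R G \<and> (x, p, y) \<in> Cl H}),
     cext = (\<lambda>c\<in>delta_C G. {x \<in> delta_R G. (x, Typ, c) \<in> Cl H}),
     den = (\<lambda>x\<in>vocabulary G. x)\<rparr>"

lemma vocabulary_eq: "vocabulary G = delta_R G"
  by (auto simp: vocabulary_def delta_R_def)

lemma finite_delta_R: "is_dgraph G \<Longrightarrow> finite (delta_R G)"
  by (auto simp: delta_R_def rdf_voc_def uni_def is_dgraph_def is_graph_def strict_version_def
      split: prod.split)

lemma canon_in_interps:
  assumes "is_dgraph G"
  shows "canon G H \<in> interps G"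
proof -
  have "finite (delta_P G)" using finite_delta_R[OF assms] delta_P_subset finite_subset by blast
  moreover have "delta_C G \<subseteq> delta_R G" by (auto simp: delta_C_def)
  moreover have "literals \<inter> delta_R G \<subseteq> delta_L G"
    by (auto simp: literals_def delta_R_def delta_L_def rdf_voc_def)
  moreover have "delta_L G \<subseteq> delta_R G" by (auto simp: delta_L_def delta_R_def)
  ultimately show ?thesis
    using finite_delta_R[OF assms]
    by (auto simp: interps_def interpretation_over_def canon_def vocabulary_eq)
qed

lemma canon_rel:
  assumes "p \<in> rdf_voc"
  shows "rel (canon G H) p = {(x, y). x \<in> delta_R G \<and> y \<in> delta_R G \<and> (x, p, y) \<in> Cl H}"
  using assms by (auto simp: rel_def canon_def vocabulary_eq delta_R_def delta_P_def)

section \<open>Canonical models and derivability\<close>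

context
  fixes G :: "('u, 'pl, 'tl) dgraph" and H :: "('u, 'pl, 'tl) triple set"
  assumes sub: "Cl H \<subseteq> Cl (strict_version G)"
begin

lemma canon_dP:
  assumes "p \<in> delta_R G"
    and "(x, p, y) \<in> Cl H \<or> (p, Sp, x) \<in> Cl H \<or> (x, Sp, p) \<in> Cl H \<or> (p, BotP, x) \<in> Cl H \<or>
      (x, BotP, p) \<in> Cl H \<or> (p, Dom, x) \<in> Cl H \<or> (p, Rng, x) \<in> Cl H"
  shows "p \<in> delta_P G"
  using assms sub unfolding delta_P_def delta_R_def by blast

lemma canon_dC:
  assumes "c \<in> delta_R G"
    and "(x, Typ, c) \<in> Cl H \<or> (x, Dom, c) \<in> Cl H \<or> (x, Rng, c) \<in> Cl H \<or> (c, Sc, x) \<in> Cl H \<or>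
      (x, Sc, c) \<in> Cl H \<or> (c, BotC, x) \<in> Cl H \<or> (x, BotC, c) \<in> Cl H"
  shows "c \<in> delta_C G"
  using assms sub unfolding delta_C_def by blast

text \<open>Membership in the domains comes from \<open>sub\<close> through \<open>canon_dP\<close>
  and \<open>canon_dC\<close>; the closure conditions mirror the derivation rules.\<close>

lemma canon_conditions: "canon G H \<tturnstile> {}"
proof -
  let ?I = "canon G H"
  have simps: "dP ?I = delta_P G" "dC ?I = delta_C G" "voc ?I = delta_R G"
    "\<And>p. p \<in> delta_P G \<Longrightarrow>
      pext ?I p = {(x, y). x \<in> delta_R G \<and> y \<in> delta_R G \<and> (x, p, y) \<in> Cl H}"
    "\<And>c. c \<in> delta_C G \<Longrightarrow> cext ?I c = {x \<in> delta_R G. (x, Typ, c) \<in> Cl H}"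
    by (simp_all add: canon_def vocabulary_eq)
  have rels: "rel ?I p = {(x, y). x \<in> delta_R G \<and> y \<in> delta_R G \<and> (x, p, y) \<in> Cl H}"
    if "p \<in> {Sp, Sc, Typ, Dom, Rng, BotC, BotP}" for p
    using canon_rel[of p G H] that by (simp add: rdf_voc_def)
  have voc: "rdf_voc \<subseteq> delta_R G" "\<forall>e\<in>rdf_voc. den ?I e \<in> delta_P G"
    by (auto simp: canon_def vocabulary_eq delta_R_def delta_P_def)
  have CR: "delta_C G \<subseteq> delta_R G" by (auto simp: delta_C_def)
  note PR = delta_P_subset[of G]
  have "sp_sc_conditions ?I"
    unfolding sp_sc_conditions_def
  proof (intro conjI)
    show "trans_on (dP ?I) (rel ?I Sp)" "trans_on (dC ?I) (rel ?I Sc)"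
      by (auto simp: rels simps trans_on_def intro: Cl.r2a Cl.r3a)
    show "\<forall>(p, q)\<in>rel ?I Sp. p \<in> dP ?I \<and> q \<in> dP ?I \<and> pext ?I p \<subseteq> pext ?I q"
    proof (clarify, goal_cases)
      case (1 p q)
      then have "p \<in> delta_P G" "q \<in> delta_P G" "(p, Sp, q) \<in> Cl H"
        by (auto simp: rels intro: canon_dP)
      then show ?case by (auto simp: simps intro: Cl.r2b)
    qed
    show "\<forall>(c, d)\<in>rel ?I Sc. c \<in> dC ?I \<and> d \<in> dC ?I \<and> cext ?I c \<subseteq> cext ?I d"
    proof (clarify, goal_cases)
      case (1 c d)
      then have "c \<in> delta_C G" "d \<in> delta_C G" "(c, Sc, d) \<in> Cl H"
        by (auto simp: rels intro: canon_dC)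
      then show ?case by (auto simp: simps intro: Cl.r3b)
    qed
  qed
  moreover have "typing_conditions ?I"
    unfolding typing_conditions_def
  proof (intro conjI)
    show "\<forall>c\<in>dC ?I. \<forall>x. x \<in> cext ?I c \<longleftrightarrow> (x, c) \<in> rel ?I Typ"
      using CR by (auto simp: simps rels)
    show "\<forall>(x, c)\<in>rel ?I Typ. c \<in> dC ?I"
      by (auto simp: simps rels intro: canon_dC)
    show "\<forall>(p, c)\<in>rel ?I Dom. p \<in> dP ?I \<and> c \<in> dC ?I \<and> (\<forall>(x, y)\<in>pext ?I p. x \<in> cext ?I c)"
    proof (clarify, goal_cases)
      case (1 p c)
      then have "p \<in> delta_P G" "c \<in> delta_C G" "(p, Dom, c) \<in> Cl H"
        by (auto simp: rels intro: canon_dC canon_dP)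
      then show ?case by (auto simp: simps intro: Cl.r4a)
    qed
    show "\<forall>(p, c)\<in>rel ?I Rng. p \<in> dP ?I \<and> c \<in> dC ?I \<and> (\<forall>(x, y)\<in>pext ?I p. y \<in> cext ?I c)"
    proof (clarify, goal_cases)
      case (1 p c)
      then have "p \<in> delta_P G" "c \<in> delta_C G" "(p, Rng, c) \<in> Cl H"
        by (auto simp: rels intro: canon_dC canon_dP)
      then show ?case by (auto simp: simps intro: Cl.r4b)
    qed
  qed
  moreover have "disjointness_conditions ?I"
    unfolding disjointness_conditions_def
  proof (intro conjI)
    show "rel ?I BotC \<subseteq> dC ?I \<times> dC ?I" "rel ?I BotP \<subseteq> dP ?I \<times> dP ?I"
      by (auto simp: simps rels intro: canon_dC canon_dP)
    show "sym (rel ?I BotC)" "sym (rel ?I BotP)"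
      by (auto simp: rels sym_def intro: Cl.r5a Cl.r6a)
    show "\<forall>c. (c, c) \<in> rel ?I BotC \<longrightarrow> (\<forall>d\<in>dC ?I. (c, d) \<in> rel ?I BotC)"
      "\<forall>p. (p, p) \<in> rel ?I BotP \<longrightarrow> (\<forall>q\<in>dP ?I. (p, q) \<in> rel ?I BotP)"
      using CR PR by (auto simp: rels simps intro: Cl.r5c Cl.r6c)
  qed (auto simp: rels intro: Cl.r5b Cl.r6b Cl.r7a Cl.r7b)
  ultimately show ?thesis
    using voc by (simp add: satisfies_empty simps)
qed

text \<open>The vocabulary has to be mentioned because \<open>r5c\<close> and \<open>r6c\<close> may
  put triples about terms outside \<open>delta_R G\<close> into \<open>Cl H\<close>.\<close>

lemma canon_satisfies_iff:
  "canon G H \<tturnstile> {t} \<longleftrightarrow> uni {t} \<subseteq> delta_R G \<and> t \<in> Cl H"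
proof (cases t)
  case (fields s p q)
  have "den (canon G H) x = x" if "x \<in> delta_R G" for x
    using that by (simp add: canon_def vocabulary_eq)
  moreover have "pext (canon G H) p =
      {(x, y). x \<in> delta_R G \<and> y \<in> delta_R G \<and> (x, p, y) \<in> Cl H}" if "p \<in> delta_P G"
    using that by (simp add: canon_def)
  moreover have "dP (canon G H) = delta_P G" "voc (canon G H) = delta_R G"
    by (simp_all add: canon_def vocabulary_eq)
  ultimately show ?thesis
    using canon_dP[of p s q] unfolding fields satisfies_triple rel_def
    by (auto simp: canon_conditions uni_def)
qed

end


section \<open>The least ranked model\<close>

text \<open>Once some lower interpretation has a nonempty subject for \<open>d\<close>, the
  interpretations minimal for \<open>d\<close> lie below, and \<open>d\<close> constrains no further
  layer. Layer \<open>0\<close> is empty, so at rank \<open>0\<close> every defeasible triple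
  counts.\<close>

fun layers :: "('u, 'pl, 'tl) dgraph \<Rightarrow> nat \<Rightarrow> ('u, 'pl, 'tl) interp set" where
  "layers G 0 = {}"
| "layers G (Suc k) = {I \<in> interps G. (\<forall>t\<in>str_part G. I \<tturnstile> {t}) \<and>
     (\<forall>d\<in>def_part G. (\<forall>J\<in>layers G k. J \<tturnstile> {bot_triple d}) \<longrightarrow>
        I \<tturnstile> {bot_triple d} \<or> I \<tturnstile> {strictify d})}"

lemmas layers_Suc_eq = layers.simps(2)
declare layers.simps(2) [simp del]

text \<open>A larger lower layer leaves fewer triples exceptional, so the condition for entering the
  next layer only weakens.\<close>

lemma layers_Suc: "layers G k \<subseteq> layers G (Suc k)"
proof (induction k)
  case (Suc k)
  show ?case
  proof
    fix I assume "I \<in> layers G (Suc k)"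
    then show "I \<in> layers G (Suc (Suc k))"
      using Suc unfolding layers_Suc_eq[of G k] layers_Suc_eq[of G "Suc k"] by blast
  qed
qed simp

lemma layers_mono: "i \<le> j \<Longrightarrow> layers G i \<subseteq> layers G j"
  using lift_Suc_mono_le[of "layers G"] layers_Suc by blast

lemma layers_interps: "layers G k \<subseteq> interps G"
  by (cases k) (auto simp: layers_Suc_eq)

text \<open>The shift by one reflects that \<open>layers G k\<close> holds the ranks below
  \<open>k\<close>. The infimum of the empty set is \<open>\<infinity>\<close>, the rank of
  interpretations that never enter.\<close>

definition layer_rank :: "('u, 'pl, 'tl) dgraph \<Rightarrow> ('u, 'pl, 'tl) ranking" where
  "layer_rank G = (\<lambda>I\<in>interps G. INF k\<in>{k. I \<in> layers G (Suc k)}. enat k)"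

lemma layer_rank_le_iff:
  assumes "I \<in> interps G"
  shows "layer_rank G I \<le> enat k \<longleftrightarrow> I \<in> layers G (Suc k)"
proof
  assume "I \<in> layers G (Suc k)"
  then show "layer_rank G I \<le> enat k"
    using assms by (auto simp: layer_rank_def intro: INF_lower)
next
  let ?K = "{k. I \<in> layers G (Suc k)}"
  assume le: "layer_rank G I \<le> enat k"
  have "?K \<noteq> {}"
  proof
    assume "?K = {}"
    then have "layer_rank G I = \<infinity>" using assms by (simp add: layer_rank_def top_enat_def)
    then show False using le by simp
  qed
  then have "(INF k\<in>?K. enat k) \<in> enat ` ?K" using wellorder_InfI[of _ "enat ` ?K"] by blast
  then obtain j where j: "j \<in> ?K" "layer_rank G I = enat j"
    using assms by (auto simp: layer_rank_def)
  then have "Suc j \<le> Suc k" using le by simp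
  then show "I \<in> layers G (Suc k)" using layers_mono[of "Suc j" "Suc k" G] j(1) by blast
qed

lemma layer_rank_less_iff:
  assumes "I \<in> interps G"
  shows "layer_rank G I < enat k \<longleftrightarrow> I \<in> layers G k"
proof (cases k)
  case (Suc j)
  have "layer_rank G I < enat (Suc j) \<longleftrightarrow> layer_rank G I \<le> enat j"
    by (cases "layer_rank G I") auto
  then show ?thesis using Suc layer_rank_le_iff[OF assms] by simp
qed (simp flip: zero_enat_def)

lemma finite_ranked_layer_rank: "finite_ranked G (layer_rank G) = (\<Union>k. layers G k)"
proof -
  have "layer_rank G I < \<infinity> \<longleftrightarrow> (\<exists>k. I \<in> layers G k)" if "I \<in> interps G" for I
  proof
    assume "layer_rank G I < \<infinity>"
    then obtain k where "layer_rank G I = enat k" by (cases "layer_rank G I") auto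
    then show "\<exists>k. I \<in> layers G k"
      using layer_rank_le_iff[OF that, of k] by (auto intro!: exI[of _ "Suc k"])
  next
    assume "\<exists>k. I \<in> layers G k"
    then obtain k where "layer_rank G I < enat k" using layer_rank_less_iff[OF \<open>I \<in> interps G\<close>] by blast
    then show "layer_rank G I < \<infinity>" using enat_ord_simps(4) less_trans by blast
  qed
  then show ?thesis using layers_interps[of G] unfolding finite_ranked_def by blast
qed

text \<open>Common form of \<open>cmin\<close> and \<open>pmin\<close>, selected by the predicate of
  \<open>d\<close>.\<close>

definition min_set :: "('u, 'pl, 'tl) dgraph \<Rightarrow> ('u, 'pl, 'tl) dtriple \<Rightarrow>
    ('u, 'pl, 'tl) ranking \<Rightarrow> ('u, 'pl, 'tl) interp set" where
  "min_set G d r = {I \<in> finite_ranked G r. \<not> I \<tturnstile> {bot_triple d} \<and>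
     (\<forall>J\<in>finite_ranked G r. \<not> J \<tturnstile> {bot_triple d} \<longrightarrow> r I \<le> r J)}"

lemma ranked_dsat_iff:
  assumes "is_dtriple d"
  shows "ranked_dsat G r d \<longleftrightarrow> (\<forall>I\<in>min_set G d r. I \<tturnstile> {strictify d})"
  using assms by (cases d) (auto simp: ranked_dsat_def min_set_def cmin_def pmin_def)

lemma layer_rank_ranked_interp:
  assumes "layers G (Suc 0) \<noteq> {}"
  shows "ranked_interp G (layer_rank G)"
  unfolding ranked_interp_def
proof (intro conjI allI impI)
  show "layer_rank G \<in> extensional (interps G)" by (simp add: layer_rank_def)
  obtain I where I: "I \<in> layers G (Suc 0)" using assms by blast
  then have "I \<in> interps G" using layers_interps by blast
  then show "0 \<in> layer_rank G ` interps G"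
    using I layer_rank_le_iff[of I G 0] by (force simp: zero_enat_def[symmetric])
next
  fix i :: nat
  assume i: "i > 0 \<and> enat i \<in> layer_rank G ` interps G"
  then obtain I where I: "I \<in> interps G" "layer_rank G I = enat i" by force
  obtain j where j: "i = Suc j" using i by (cases i) auto
  have new: "I \<in> layers G (Suc i)" "I \<notin> layers G i"
    using I layer_rank_le_iff[OF I(1), of i] layer_rank_less_iff[OF I(1), of i] by auto
  \<comment> \<open>Each layer is determined by the previous one: if nothing had entered at stage
    \<open>i\<close>, nothing could enter at stage \<open>Suc i\<close>, where \<open>I\<close> is
    new.\<close>
  have "layers G j \<noteq> layers G i"
  proof
    assume eq: "layers G j = layers G i"
    have "layers G (Suc j) = layers G (Suc i)" unfolding layers_Suc_eq eq ..
    then show False using new j by simp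
  qed
  then obtain J where J: "J \<in> layers G i" "J \<notin> layers G j" using layers_Suc[of G j] j by blast
  then have "J \<in> interps G" using layers_interps by blast
  moreover have "layer_rank G J = enat j"
    using J j layer_rank_le_iff[OF calculation, of j] layer_rank_less_iff[OF calculation, of j]
    by (simp add: order.antisym not_less)
  ultimately show "enat (i - 1) \<in> layer_rank G ` interps G" using j by force
qed

text \<open>If \<open>I\<close> has rank \<open>i\<close> and is minimal for \<open>d\<close>, then
  all of \<open>layers G i\<close> makes the subject of \<open>d\<close> empty. So \<open>d\<close>
  was still exceptional when \<open>I\<close> entered, and \<open>I\<close>, whose own subject is
  not empty, must satisfy it.\<close>

lemma layer_rank_ranked_model:
  assumes "is_dgraph G" and "layers G (Suc 0) \<noteq> {}"
  shows "ranked_model G (layer_rank G)"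
  unfolding ranked_model_def
proof (intro conjI ballI)
  show "ranked_interp G (layer_rank G)" using layer_rank_ranked_interp assms(2) by blast
next
  fix t assume t: "t \<in> str_part G"
  have "I \<tturnstile> {t}" if "I \<in> layers G k" for I k
    using t that by (cases k) (auto simp: layers_Suc_eq)
  then show "ranked_sat G (layer_rank G) t"
    by (auto simp: ranked_sat_def finite_ranked_layer_rank)
next
  fix d assume d: "d \<in> def_part G"
  have "I \<tturnstile> {strictify d}" if I: "I \<in> min_set G d (layer_rank G)" for I
  proof -
    have II: "I \<in> interps G" and fin: "layer_rank G I < \<infinity>"
      using I by (auto simp: min_set_def finite_ranked_def)
    then obtain i where i: "layer_rank G I = enat i" by (cases "layer_rank G I") auto
    then have "I \<in> layers G (Suc i)" using layer_rank_le_iff[OF II] by force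
    moreover have "J \<tturnstile> {bot_triple d}" if "J \<in> layers G i" for J
    proof (rule ccontr)
      assume "\<not> J \<tturnstile> {bot_triple d}"
      moreover have "J \<in> finite_ranked G (layer_rank G)"
        using that by (auto simp: finite_ranked_layer_rank)
      ultimately have "layer_rank G I \<le> layer_rank G J" using I by (auto simp: min_set_def)
      moreover have "layer_rank G J < enat i"
        using that layer_rank_less_iff layers_interps by blast
      ultimately show False using i by simp
    qed
    ultimately show ?thesis using I d by (auto simp: min_set_def layers_Suc_eq)
  qed
  moreover have "is_dtriple d" using d assms(1) by (auto simp: is_dgraph_def)
  ultimately show "ranked_dsat G (layer_rank G) d" by (simp add: ranked_dsat_iff)
qed

text \<open>Strong induction on the rank under \<open>r\<close>. If \<open>I\<close> violates an
  exceptional \<open>d\<close> without making its subject empty, then \<open>I\<close> is not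
  minimal for \<open>d\<close>; a witness \<open>J\<close> of smaller rank is in
  \<open>layers G k\<close> by induction, contradicting exceptionality.\<close>

lemma layer_rank_least:
  assumes "is_dgraph G" and r: "ranked_model G r"
  shows "rank_le G (layer_rank G) r"
proof -
  have "I \<in> layers G (Suc k)" if "I \<in> interps G" "r I = enat k" for I k
    using that
  proof (induction k arbitrary: I rule: less_induct)
    case (less k)
    have fin: "I \<in> finite_ranked G r" using less.prems by (simp add: finite_ranked_def)
    have "I \<tturnstile> {bot_triple d} \<or> I \<tturnstile> {strictify d}"
      if d: "d \<in> def_part G" "\<forall>J\<in>layers G k. J \<tturnstile> {bot_triple d}" for d
    proof (rule disjCI)
      assume nd: "\<not> I \<tturnstile> {strictify d}"
      have "ranked_dsat G r d" "is_dtriple d"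
        using d r assms(1) by (auto simp: ranked_model_def is_dgraph_def)
      then have "I \<notin> min_set G d r" using nd by (auto simp: ranked_dsat_iff)
      moreover have "r I \<le> r J" if "J \<in> finite_ranked G r" "\<not> J \<tturnstile> {bot_triple d}" for J
      proof (rule ccontr)
        assume "\<not> r I \<le> r J"
        then obtain j where j: "r J = enat j" "j < k" using less.prems by (cases "r J") auto
        then have "J \<in> layers G (Suc j)" using less.IH that by (simp add: finite_ranked_def)
        then have "J \<in> layers G k" using layers_mono[of "Suc j" k G] j(2) by auto
        then show False using d that by blast
      qed
      ultimately show "I \<tturnstile> {bot_triple d}" using fin unfolding min_set_def by blast
    qed
    moreover have "\<forall>t\<in>str_part G. I \<tturnstile> {t}"
      using r fin by (auto simp: ranked_model_def ranked_sat_def)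
    ultimately show ?case using less.prems by (simp add: layers_Suc_eq)
  qed
  then have "layer_rank G I \<le> r I" if "I \<in> interps G" for I
    using that layer_rank_le_iff[OF that] by (cases "r I") auto
  then show ?thesis by (simp add: rank_le_def)
qed

text \<open>A least ranked model is the only minimal one, which gives the \<open>THE\<close> its
  meaning. Ranks agree on \<open>interps G\<close> by antisymmetry and elsewhere by
  extensionality.\<close>

lemma min_ranked_model_eq:
  assumes "is_dgraph G" and "layers G (Suc 0) \<noteq> {}"
  shows "min_ranked_model G = layer_rank G"
  unfolding min_ranked_model_def
proof (rule the_equality)
  note model = layer_rank_ranked_model[OF assms]
  show "minimal_ranked_model G (layer_rank G)"
    unfolding minimal_ranked_model_def
  proof (intro conjI allI impI model)
    fix r assume r: "ranked_model G r \<and> rank_le G r (layer_rank G)"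
    then have "r I = layer_rank G I" if "I \<in> interps G" for I
      using that layer_rank_least[OF assms(1), of r] by (auto simp: rank_le_def intro: order.antisym)
    moreover have "r \<in> extensional (interps G)" "layer_rank G \<in> extensional (interps G)"
      using r model by (auto simp: ranked_model_def ranked_interp_def)
    ultimately show "r = layer_rank G" by (intro extensionalityI)
  qed
  show "r = layer_rank G" if "minimal_ranked_model G r" for r
    using that model layer_rank_least[OF assms(1), of r] unfolding minimal_ranked_model_def by blast
qed


section \<open>The ranking procedure\<close>

lemma D_seq_subset: "D_seq G i \<subseteq> def_part G"
  by (induction i) auto

lemma D_seq_Suc:
  assumes "is_dgraph G"
  shows "D_seq G (Suc i) =
    {d \<in> D_seq G i. bot_triple d \<in> Cl (str_part G \<union> strictify ` D_seq G i)}"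
    (is "_ = ?R")
proof (rule set_eqI)
  fix d
  have "is_dtriple d" if "d \<in> D_seq G i"
    using that D_seq_subset assms by (auto simp: is_dgraph_def)
  then show "d \<in> D_seq G (Suc i) \<longleftrightarrow> d \<in> ?R"
    by (cases d) (auto simp: derives_def)
qed

text \<open>\<open>def_part G\<close> is finite and every proper step loses a triple. The
  fixed-point equation later makes the emptiness of each subject in
  \<open>D\<^sub>\<infinity>\<close> derivable from stage \<open>n\<close> itself.\<close>

lemma D_seq_stationary:
  assumes "is_dgraph G"
  obtains n where "snd (Ranking G) = D_seq G n" "D_seq G (Suc n) = D_seq G n"
proof -
  have "\<exists>n. D_seq G n = D_seq G (Suc n)"
  proof (rule ccontr)
    assume ne: "\<nexists>n. D_seq G n = D_seq G (Suc n)"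
    have less: "card (D_seq G (Suc n)) < card (D_seq G n)" for n
    proof (rule psubset_card_mono)
      show "finite (D_seq G n)"
        using finite_subset[OF D_seq_subset] assms by (auto simp: is_dgraph_def)
      have "D_seq G (Suc n) \<subseteq> D_seq G n" unfolding D_seq_Suc[OF assms] by blast
      then show "D_seq G (Suc n) \<subset> D_seq G n" using ne by (metis psubsetI)
    qed
    have "card (D_seq G n) + n \<le> card (D_seq G 0)" for n
    proof (induction n)
      case (Suc n)
      then show ?case using less[of n] by linarith
    qed simp
    from this[of "Suc (card (D_seq G 0))"] show False by simp
  qed
  from LeastI_ex[OF this] show thesis
    by (intro that[of "LEAST n. D_seq G n = D_seq G (Suc n)"]) (simp_all add: Ranking_def Let_def)
qed

definition query_graph :: "('u, 'pl, 'tl) dgraph \<Rightarrow> ('u, 'pl, 'tl) triple set" where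
  "query_graph G = str_part G \<union> bot_triple ` snd (Ranking G)"

context
  fixes G :: "('u, 'pl, 'tl) dgraph"
  assumes G: "is_dgraph G"
begin

lemma StrictMinEntailment_iff: "StrictMinEntailment G (Ranking G) t \<longleftrightarrow> t \<in> Cl (query_graph G)"
proof -
  let ?D = "snd (Ranking G)"
  have dt: "is_dtriple d" if "d \<in> ?D" for d
    using that D_seq_stationary[OF G] D_seq_subset G unfolding is_dgraph_def by (metis subsetD)
  have "bot_triple ` ?D =
      {(a, BotC, a) | a b. \<langle>a, Sc, b\<rangle> \<in> ?D} \<union> {(a, BotP, a) | a b. \<langle>a, Sp, b\<rangle> \<in> ?D}"
  proof (intro equalityI subsetI)
    fix t assume "t \<in> bot_triple ` ?D"
    then obtain d where "d \<in> ?D" "t = bot_triple d" by blast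
    then show "t \<in> {(a, BotC, a) | a b. \<langle>a, Sc, b\<rangle> \<in> ?D} \<union> {(a, BotP, a) | a b. \<langle>a, Sp, b\<rangle> \<in> ?D}"
      using dt[of d] by (cases d) auto
  next
    fix t :: "('u, 'pl, 'tl) triple"
    assume "t \<in> {(a, BotC, a) | a b. \<langle>a, Sc, b\<rangle> \<in> ?D} \<union> {(a, BotP, a) | a b. \<langle>a, Sp, b\<rangle> \<in> ?D}"
    then obtain a b where "t = bot_triple \<langle>a, Sc, b\<rangle> \<and> \<langle>a, Sc, b\<rangle> \<in> ?D \<or>
        t = bot_triple \<langle>a, Sp, b\<rangle> \<and> \<langle>a, Sp, b\<rangle> \<in> ?D"
      by auto
    then show "t \<in> bot_triple ` ?D" by blast
  qed
  then show ?thesis by (simp add: StrictMinEntailment_def query_graph_def derives_def Un_assoc)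
qed

section \<open>Stages of the procedure and layers of the ranking\<close>

lemma stage_properties:
  defines "H \<equiv> \<lambda>i. str_part G \<union> strictify ` D_seq G i"
  shows "H i \<subseteq> strict_version G" "Cl (H i) \<subseteq> Cl (strict_version G)"
    "\<forall>t\<in>str_part G. is_triple t" "\<forall>d\<in>D_seq G i. is_dtriple d"
proof -
  show "H i \<subseteq> strict_version G" using D_seq_subset by (auto simp: strict_version_def H_def)
  then have "H i \<subseteq> Cl (strict_version G)" by (blast intro: Cl.base)
  then show "Cl (H i) \<subseteq> Cl (strict_version G)" by (blast intro: Cl_mono)
  show "\<forall>t\<in>str_part G. is_triple t" "\<forall>d\<in>D_seq G i. is_dtriple d"
    using G D_seq_subset[of G i] by (auto simp: is_dgraph_def is_graph_def)
qed

text \<open>At the fixed point each added disjointness triple is derivable from its stage, hence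
  from \<open>strict_version G\<close>. This makes the canonical model of the query graph
  available.\<close>

lemma query_graph_properties:
  shows "Cl (query_graph G) \<subseteq> Cl (strict_version G)" "\<forall>t\<in>query_graph G. is_triple t"
    "uni (query_graph G) \<subseteq> delta_R G"
proof -
  obtain n where n: "snd (Ranking G) = D_seq G n" "D_seq G (Suc n) = D_seq G n"
    using D_seq_stationary[OF G] .
  have "bot_triple d \<in> Cl (strict_version G)" if "d \<in> D_seq G n" for d
    using that n(2) D_seq_Suc[OF G, of n] stage_properties(2)[of n] by auto
  then have "query_graph G \<subseteq> Cl (strict_version G)"
    by (auto simp: query_graph_def n(1) strict_version_def intro: Cl.base)
  then show "Cl (query_graph G) \<subseteq> Cl (strict_version G)" using Cl_mono by blast
  show "\<forall>t\<in>query_graph G. is_triple t"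
    using stage_properties(3) stage_properties(4)[of n] is_triple_bot
    unfolding query_graph_def n(1) by blast
  have "uni {bot_triple d} \<subseteq> delta_R G" if "d \<in> D_seq G n" for d
    using uni_bot[of d] uni_mono[of "{strictify d}" "strict_version G"] that D_seq_subset[of G n]
    by (auto simp: delta_R_def strict_version_def)
  moreover have "uni (str_part G) \<subseteq> delta_R G"
    using uni_mono[of "str_part G" "strict_version G"] by (auto simp: delta_R_def strict_version_def)
  moreover have "uni (query_graph G) = uni (str_part G) \<union> (\<Union>d\<in>D_seq G n. uni {bot_triple d})"
    by (simp add: query_graph_def n(1) uni_def)
  ultimately show "uni (query_graph G) \<subseteq> delta_R G" by blast
qed

lemma stage_canon_satisfies:
  assumes "t \<in> str_part G \<union> strictify ` D_seq G i"
  shows "canon G (str_part G \<union> strictify ` D_seq G i) \<tturnstile> {t}"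
proof -
  have "uni {t} \<subseteq> delta_R G"
    using uni_mono[of "{t}" "strict_version G"] assms stage_properties(1)[of i]
    by (auto simp: delta_R_def)
  then show ?thesis
    unfolding canon_satisfies_iff[OF stage_properties(2)] using Cl.base[OF assms] by (rule conjI)
qed

text \<open>By induction, the canonical model of stage \<open>k\<close> satisfies all triples
  exceptional for layer \<open>k\<close>, so it enters layer \<open>Suc k\<close>. If
  \<open>d\<close> is exceptional there, this model makes its subject empty; so stage
  \<open>k\<close> derives the emptiness and \<open>d\<close> survives.\<close>

lemma exceptional_in_D_seq:
  assumes "d \<in> def_part G" and "\<forall>J\<in>layers G k. J \<tturnstile> {bot_triple d}"
  shows "d \<in> D_seq G k"
  using assms
proof (induction k arbitrary: d)
  case (Suc k)
  let ?H = "str_part G \<union> strictify ` D_seq G k"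
  have "canon G ?H \<in> layers G (Suc k)"
    using Suc.IH stage_canon_satisfies[of _ k] canon_in_interps[OF G] by (simp add: layers_Suc_eq)
  then have "canon G ?H \<tturnstile> {bot_triple d}" using Suc.prems(2) by blast
  then have "bot_triple d \<in> Cl ?H"
    unfolding canon_satisfies_iff[OF stage_properties(2)] by (rule conjunct2)
  moreover have "d \<in> D_seq G k" using Suc layers_Suc[of G k] by blast
  ultimately show ?case unfolding D_seq_Suc[OF G] by blast
qed simp

text \<open>Only triples of \<open>D_seq G n\<close> constrain the entry into layer
  \<open>Suc n\<close>, and the query graph declares all their subjects empty.\<close>

lemma query_canon_in_layers: "\<exists>k. canon G (query_graph G) \<in> layers G k"
proof -
  obtain n where n: "snd (Ranking G) = D_seq G n"
    using D_seq_stationary[OF G] .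
  have "canon G (query_graph G) \<tturnstile> {t}" if "t \<in> query_graph G" for t
    unfolding canon_satisfies_iff[OF query_graph_properties(1)]
    using that query_graph_properties(3) uni_mono[of "{t}" "query_graph G"] Cl.base[OF that] by simp
  then have "canon G (query_graph G) \<in> layers G (Suc n)"
    using exceptional_in_D_seq canon_in_interps[OF G] by (auto simp: query_graph_def n layers_Suc_eq)
  then show ?thesis ..
qed

text \<open>Induction on the layer: if all lower interpretations make the subjects in
  \<open>D\<^sub>\<infinity>\<close> empty, its triples are exceptional, so \<open>I\<close>
  satisfies each of them or makes its subject empty. As stage \<open>n\<close> derives every such
  emptiness, \<open>Cl_disjointness_sound\<close> gives emptiness throughout.\<close>

lemma layers_satisfy_query_graph:
  assumes "I \<in> layers G k" and "t \<in> query_graph G"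
  shows "I \<tturnstile> {t}"
proof -
  obtain n where n: "snd (Ranking G) = D_seq G n" "D_seq G (Suc n) = D_seq G n"
    using D_seq_stationary[OF G] .
  let ?H = "str_part G \<union> strictify ` D_seq G n"
  note stage = stage_properties(1,2,4)[of n]
  have derivable: "bot_triple d \<in> Cl ?H" if "d \<in> D_seq G n" for d
    using that n(2) D_seq_Suc[OF G, of n] by auto
  have "I \<tturnstile> {bot_triple d}" if "d \<in> D_seq G n" for d
    using assms(1) that
  proof (induction k arbitrary: I d)
    case (Suc k)
    have I: "I \<in> interps G" and str: "\<forall>t\<in>str_part G. I \<tturnstile> {t}"
      using Suc.prems(1) by (simp_all add: layers_Suc_eq)
    have ok: "\<forall>d\<in>D_seq G n. I \<tturnstile> {bot_triple d} \<or> I \<tturnstile> {strictify d}"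
      using Suc.prems(1) Suc.IH D_seq_subset[of G n] unfolding layers_Suc_eq by blast
    have uni: "uni ?H \<subseteq> voc I"
      using uni_mono[OF stage(1)] interps_den(1)[OF I] by (auto simp: delta_R_def)
    have "uni {strictify d} \<subseteq> uni ?H" using Suc.prems(2) by (intro uni_mono) simp
    then have "uni {bot_triple d} \<subseteq> voc I"
      using uni_bot[of d] uni interps_den(1)[OF I] by (auto simp: delta_R_def)
    moreover have "(A, BotC, A) \<in> Cl ?H \<Longrightarrow> den I ` voc I \<subseteq> dC I"
      "(A, BotP, A) \<in> Cl ?H \<Longrightarrow> den I ` voc I \<subseteq> dP I" for A
      using interps_total[OF I] stage(2) by blast+
    note Cl_disjointness_sound[OF derivable[OF Suc.prems(2)] stage_properties(3) stage(3)
        str ok uni this]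
    ultimately show ?case by (cases d) (simp add: uni_def split: if_splits)
  qed simp
  moreover have "I \<tturnstile> {t}" if "t \<in> str_part G"
    using assms(1) that by (cases k) (auto simp: layers_Suc_eq)
  ultimately show ?thesis using assms(2) by (auto simp: query_graph_def n(1))
qed

text \<open>The canonical model of the query graph refutes what is not derivable;
  \<open>Cl_sound\<close> gives the converse, for which a derivable triple has to lie in the
  vocabulary.\<close>

lemma layers_satisfy_iff:
  assumes "uni {t} \<subseteq> delta_R G \<or> t \<notin> Cl (query_graph G)"
  shows "(\<forall>k. \<forall>I\<in>layers G k. I \<tturnstile> {t}) \<longleftrightarrow> t \<in> Cl (query_graph G)"
proof
  assume "\<forall>k. \<forall>I\<in>layers G k. I \<tturnstile> {t}"
  then have "canon G (query_graph G) \<tturnstile> {t}" using query_canon_in_layers by blast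
  then show "t \<in> Cl (query_graph G)"
    unfolding canon_satisfies_iff[OF query_graph_properties(1)] by (rule conjunct2)
next
  assume t: "t \<in> Cl (query_graph G)"
  show "\<forall>k. \<forall>I\<in>layers G k. I \<tturnstile> {t}"
  proof (intro allI ballI)
    fix k I assume k: "I \<in> layers G k"
    then have I: "I \<in> interps G" using layers_interps by blast
    have "uni {t} \<subseteq> voc I" "uni (query_graph G) \<subseteq> voc I"
      using assms t query_graph_properties(3) interps_den(1)[OF I] by auto
    then show "I \<tturnstile> {t}"
      by (intro Cl_sound[OF t query_graph_properties(2)] ballI layers_satisfy_query_graph[OF k]
          interps_total[OF I] subsetD[OF query_graph_properties(1)])
  qed
qed

lemma min_entails_iff: "G \<Turnstile>\<^sub>m\<^sub>i\<^sub>n t \<longleftrightarrow> (\<forall>k. \<forall>I\<in>layers G k. I \<tturnstile> {t})"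
proof -
  \<comment> \<open>Stage \<open>0\<close> is the whole strict version; its canonical model
    satisfies every triple outright, so rank \<open>0\<close> is attained.\<close>
  have "canon G (str_part G \<union> strictify ` D_seq G 0) \<in> layers G (Suc 0)"
    using stage_canon_satisfies[of _ 0] canon_in_interps[OF G] by (simp add: layers_Suc_eq)
  then have "min_ranked_model G = layer_rank G" using min_ranked_model_eq[OF G] by blast
  then show ?thesis by (auto simp: min_entails_def ranked_sat_def finite_ranked_layer_rank)
qed

end

text \<open>\<open>r5c\<close> and \<open>r6c\<close> derive disjointness triples about arbitrary
  terms, while an interpretation satisfies only triples over its vocabulary; hence the assumption on
  the terms of such triples. For every other predicate, derivability already keeps the terms within
  the query graph.\<close>

theorem theorem3p22:
  fixes G :: "('u, 'pl, 'tl) dgraph"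
    and s p o' :: "('u, 'pl, 'tl) rdf_term"
  assumes "is_dgraph G"
    and "is_triple (s, p, o')"
    and "p \<in> {BotC, BotP} \<longrightarrow> {s, o'} \<subseteq> uni (strict_version G)"
  shows "G \<Turnstile>\<^sub>m\<^sub>i\<^sub>n (s, p, o') \<longleftrightarrow> StrictMinEntailment G (Ranking G) (s, p, o')"
proof -
  have "uni {(s, p, o')} \<subseteq> delta_R G" if t: "(s, p, o') \<in> Cl (query_graph G)"
  proof -
    note props = query_graph_properties[OF assms(1)]
    have "p \<in> delta_R G" using Cl_predicate[OF t props(2)] props(3) by (auto simp: delta_R_def)
    moreover have "s \<in> delta_R G \<and> o' \<in> delta_R G"
    proof (cases "p \<in> {BotC, BotP}")
      case True
      then show ?thesis using assms(3) by (auto simp: delta_R_def)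
    next
      case False
      then show ?thesis using Cl_terms[OF t props(2)] props(3) by auto
    qed
    ultimately show ?thesis by (simp add: uni_def)
  qed
  then show ?thesis
    using layers_satisfy_iff[OF assms(1)] min_entails_iff[OF assms(1)]
      StrictMinEntailment_iff[OF assms(1)] by blast
qed

end
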